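(* Fix an odd integer $d\geq 1$. Let $P$ and $Q$ be Borel probability measures on $\mathbb{R}^d$. Let $\Omega\subset\mathbb{R}^d$ be an open subset, and assume that $F_P^{\mathrm g}(x)=F_Q^{\mathrm g}(x)$ for all $x\in\Omega$. Then $P$ and $Q$ coincide over $\Omega$, i.e. $P(E)=Q(E)$ for all Borel subsets $E\subset\Omega$.
   Context: For a Borel probability measure $P$ on $\mathbb{R}^d$, the geometric cdf $F_P^{\mathrm g}:\mathbb{R}^d\to\mathbb{R}^d$ is $F_P^{\mathrm g}(x)=\mathbb{E}\big[\frac{x-Z}{\|x-Z\|}\mathbb{I}[Z\neq x]\big]$, where $Z$ is a random vector with law $P$ and $\|\cdot\|$ is the Euclidean norm. *)

theory Defs
  imports "HOL-Probability.Probability"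
begin

definition borel_probability :: "'a::topological_space measure \<Rightarrow> bool" where
  "borel_probability P \<longleftrightarrow> prob_space P \<and> sets P = sets borel"

text \<open>The expectation over a random vector with law \<open>P\<close> is written as the
  Bochner integral over \<open>P\<close>; the norm on \<open>real ^ 'd\<close> is the Euclidean one.\<close>

definition geometric_cdf :: "(real ^ 'd) measure \<Rightarrow> real ^ 'd \<Rightarrow> real ^ 'd" where
  "geometric_cdf P x =
     (\<integral>z. indicator {z. z \<noteq> x} z *\<^sub>R ((x - z) /\<^sub>R norm (x - z)) \<partial>P)"

end

theory Submission
  imports Defs
begin

text \<open>
  Write \<open>d = 2 m - 1\<close>. The geometric cdf of \<open>P\<close> at \<open>x\<close> is the \<open>P\<close>-mean of \<open>sgn (x - z)\<close>, which is the
  gradient in \<open>x\<close> of \<open>\<bar>x - z\<bar>\<close>, and in odd dimension \<open>\<bar>x\<bar>\<close> is, up to a constant, a fundamental solution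
  of an integer power of the Laplacian: \<open>\<Delta>\<^sup>m \<bar>x\<bar> = C \<delta>\<^sub>0\<close> with \<open>C \<noteq> 0\<close>. Integrating by parts, a test function
  \<open>\<phi>\<close> supported in \<open>\<Omega>\<close> satisfies \<open>C \<phi>(z) = \<integral> V(x) \<bullet> sgn (x - z) dx\<close> for the field
  \<open>V = - \<nabla> \<Delta>\<^bsup>m - 1\<^esup> \<phi>\<close>, again supported in \<open>\<Omega>\<close>. By Fubini, \<open>C \<integral> \<phi> dP\<close> is the integral of \<open>V\<close> against
  the geometric cdf of \<open>P\<close> over \<open>\<Omega>\<close>, so \<open>P\<close> and \<open>Q\<close> give \<open>\<phi>\<close> the same integral. This local
  inversion is where oddness enters: in even dimension the power of the Laplacian is fractional.

  The proof runs without distributions. The test functions are the bumps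
  \<open>(max 0 (R - \<bar>x - a\<bar>\<^sup>2))\<^sup>N\<close>, and \<open>\<bar>x\<bar>\<close> is replaced by \<open>(c + \<bar>x\<bar>\<^sup>2)\<^bsup>1/2\<^esup>\<close>. Both are powers of an
  affine function of the squared distance to a point, and the closed form of their iterated
  Laplacians is the same up to a sign (\<open>radial_laplacian_iter_profile\<close>). For the regularised norm all
  terms of the \<open>m\<close>-th Laplacian but one vanish (\<open>iter_profile_critical\<close>), leaving a multiple of
  \<open>c\<^sup>m (c + \<bar>x\<bar>\<^sup>2)\<^bsup>1/2 - 2m\<^esup>\<close>, which is an approximate identity as \<open>c\<close> tends to 0
  (\<open>approximate_identity_powr\<close>). Together with Green's identity (\<open>green_radial\<close>) this yields the
  representation of bumps in \<open>bump_as_sgn_potential\<close>.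

  Finally the bumps of radius \<open>r\<close> are averaged over all centres \<open>a\<close> with \<open>cball a r \<subseteq> U\<close>. For a bounded
  open \<open>U \<subseteq> \<Omega>\<close> and after normalisation this tends boundedly to the indicator of \<open>U\<close>, so
  \<open>P\<close> and \<open>Q\<close> agree on such \<open>U\<close> (\<open>measure_open_eq_of_bump_integrals\<close>), hence on all Borel subsets of \<open>\<Omega>\<close>.
\<close>

section \<open>Integrals of directional derivatives\<close>

lemma integrable_continuous_bounded_support:
  fixes f :: "'a::euclidean_space \<Rightarrow> 'b::{banach, second_countable_topology}"
  assumes f: "continuous_on UNIV f" and supp: "\<And>x. r < norm x \<Longrightarrow> f x = 0"
  shows "integrable lborel f"
proof -
  have "integrable lborel (\<lambda>x. indicator (cball 0 r) x *\<^sub>R f x)"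
    using f by (intro borel_integrable_compact) (auto intro: continuous_on_subset)
  moreover have "(\<lambda>x. indicator (cball 0 r) x *\<^sub>R f x) = f"
    using supp by (auto simp: indicator_def fun_eq_iff not_le)
  ultimately show ?thesis by simp
qed

lemma bounded_continuous_bounded_support:
  fixes f :: "'a::euclidean_space \<Rightarrow> real"
  assumes f: "continuous_on UNIV f" and supp: "\<And>x. r < norm x \<Longrightarrow> f x = 0"
  obtains M where "0 \<le> M" "\<And>x. \<bar>f x\<bar> \<le> M"
proof -
  have "compact (f ` cball 0 r)"
    using f by (intro compact_continuous_image) (auto intro: continuous_on_subset)
  then have "bounded (f ` cball 0 r)" by (rule compact_imp_bounded)
  then obtain M where M: "\<And>x. norm x \<le> r \<Longrightarrow> \<bar>f x\<bar> \<le> M"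
    unfolding bounded_iff by force
  have "\<bar>f x\<bar> \<le> max M 0" for x
    using M[of x] supp[of x] by (cases "norm x \<le> r") auto
  then show thesis using that[of "max M 0"] by simp
qed

text \<open>The difference quotients of \<open>h\<close> have integral 0 by translation invariance of Lebesgue measure, and
  they converge to \<open>h'\<close> boundedly on a common ball. This takes the place of the divergence theorem.\<close>

lemma integral_directional_derivative_eq_0:
  fixes h h' :: "'a::euclidean_space \<Rightarrow> real"
  assumes der: "\<And>x. ((\<lambda>t. h (x + t *\<^sub>R e)) has_real_derivative h' x) (at 0)"
    and h: "continuous_on UNIV h" and h': "continuous_on UNIV h'"
    and supp: "\<And>x. r < norm x \<Longrightarrow> h x = 0" and supp': "\<And>x. r < norm x \<Longrightarrow> h' x = 0"
  shows "integral\<^sup>L lborel h' = 0"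
proof -
  define q where "q n x = (h (x + (1 / real (Suc n)) *\<^sub>R e) - h x) / (1 / real (Suc n))" for n x
  have int_h: "integrable lborel h"
    using h supp by (rule integrable_continuous_bounded_support)
  have shift: "integrable lborel (\<lambda>x. h (x + v)) \<and> (\<integral>x. h (x + v) \<partial>lborel) = integral\<^sup>L lborel h" for v
  proof -
    have *: "(lborel :: 'a measure) = distr lborel borel (\<lambda>x. v + x)"
      by (rule lborel_distr_plus[symmetric])
    have hm: "h \<in> borel_measurable borel"
      using h by (intro borel_measurable_continuous_onI)
    have "integrable (distr lborel borel (\<lambda>x. v + x)) h" using int_h * by simp
    then have "integrable lborel (\<lambda>x. h (v + x))"
      using hm by (subst (asm) integrable_distr_eq) auto
    moreover have "integral\<^sup>L lborel h = (\<integral>x. h (v + x) \<partial>lborel)"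
      using hm by (subst *, subst integral_distr) auto
    ultimately show ?thesis by (simp add: add.commute)
  qed
  have q0: "integral\<^sup>L lborel (q n) = 0" for n
    unfolding q_def using shift[of "(1 / real (Suc n)) *\<^sub>R e"] int_h
    by (simp add: Bochner_Integration.integral_diff)
  obtain M where M: "0 \<le> M" "\<And>x. \<bar>h' x\<bar> \<le> M"
    using bounded_continuous_bounded_support[OF h' supp'] by blast
  have der_t: "((\<lambda>t. h (x + t *\<^sub>R e)) has_real_derivative h' (x + t *\<^sub>R e)) (at t)" for x t
  proof -
    have "((\<lambda>u. h ((x + t *\<^sub>R e) + (u - t) *\<^sub>R e)) has_real_derivative h' (x + t *\<^sub>R e) * 1) (at t)"
      by (rule DERIV_chain'[where f = "\<lambda>u. u - t" and g = "\<lambda>s. h ((x + t *\<^sub>R e) + s *\<^sub>R e)"])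
         (auto intro!: derivative_eq_intros der)
    then show ?thesis by (simp add: algebra_simps)
  qed
  have bnd: "\<bar>q n x\<bar> \<le> M * indicator (cball 0 (r + norm e)) x" for n x
  proof (cases "norm x \<le> r + norm e")
    case True
    let ?t = "1 / real (Suc n)"
    have "\<exists>z>0. z < ?t \<and> h (x + ?t *\<^sub>R e) - h (x + 0 *\<^sub>R e) = (?t - 0) * h' (x + z *\<^sub>R e)"
      by (rule MVT2) (use der_t in auto)
    then obtain z where "h (x + ?t *\<^sub>R e) - h x = ?t * h' (x + z *\<^sub>R e)" by auto
    then have "q n x = h' (x + z *\<^sub>R e)" unfolding q_def by simp
    then show ?thesis using M True by simp
  next
    case False
    let ?t = "1 / real (Suc n)"
    have "norm (?t *\<^sub>R e) \<le> norm e" by (simp add: divide_simps mult_left_mono) (simp add: algebra_simps)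
    moreover have "norm x \<le> norm (x + ?t *\<^sub>R e) + norm (?t *\<^sub>R e)"
      using norm_triangle_ineq4[of "x + ?t *\<^sub>R e" "?t *\<^sub>R e"] by simp
    ultimately have "r < norm (x + ?t *\<^sub>R e)" "r < norm x" using False norm_ge_zero[of e] by linarith+
    then show ?thesis using supp M by (simp add: q_def)
  qed
  have lim: "(\<lambda>n. q n x) \<longlonglongrightarrow> h' x" for x
  proof -
    have "((\<lambda>t. (h (x + t *\<^sub>R e) - h x) / t) \<longlongrightarrow> h' x) (at 0)"
      using der[of x] by (simp add: has_field_derivative_iff)
    moreover have "filterlim (\<lambda>n. 1 / real (Suc n)) (at 0) sequentially"
      unfolding filterlim_at using LIMSEQ_inverse_real_of_nat
      by (auto simp: inverse_eq_divide)
    ultimately show ?thesis unfolding q_def by (rule filterlim_compose)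
  qed
  have meas: "h \<in> borel_measurable borel" "h' \<in> borel_measurable borel"
    using h h' by (auto intro: borel_measurable_continuous_onI)
  have "(\<lambda>n. integral\<^sup>L lborel (q n)) \<longlonglongrightarrow> integral\<^sup>L lborel h'"
  proof (rule integral_dominated_convergence)
    show "integrable lborel (\<lambda>x::'a. M * indicator (cball 0 (r + norm e)) x)"
      by (intro integrable_mult_right integrable_real_indicator)
         (use emeasure_lborel_cball_finite[of "0::'a"] in \<open>auto simp: less_top\<close>)
    show "q n \<in> borel_measurable lborel" for n
      unfolding q_def using meas by measurable
  qed (use meas lim bnd in auto)
  then show ?thesis using q0 by (simp add: LIMSEQ_const_iff)
qed

section \<open>Green's identity for radial functions\<close>

text \<open>If \<open>g1\<close> and \<open>g2\<close> are the first two derivatives of \<open>g\<close>, this is the profile of the Laplacian of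
  \<open>x \<mapsto> g (\<bar>x - a\<bar>\<^sup>2)\<close> in dimension \<open>d\<close>.\<close>

definition radial_laplacian :: "real \<Rightarrow> (real \<Rightarrow> real) \<Rightarrow> (real \<Rightarrow> real) \<Rightarrow> real \<Rightarrow> real" where
  "radial_laplacian d g1 g2 t = 2 * d * g1 t + 4 * t * g2 t"

lemma has_derivative_radial:
  fixes a e :: "'a::euclidean_space"
  assumes "\<And>t. 0 \<le> t \<Longrightarrow> (g has_real_derivative g1 t) (at t)"
  shows "((\<lambda>t. g ((norm (x + t *\<^sub>R e - a))\<^sup>2)) has_real_derivative
           2 * ((x - a) \<bullet> e) * g1 ((norm (x - a))\<^sup>2)) (at 0)"
proof -
  have eq: "(norm (x + t *\<^sub>R e - a))\<^sup>2 = (norm (x - a))\<^sup>2 + t * (2 * ((x - a) \<bullet> e)) + t\<^sup>2 * (e \<bullet> e)" for t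
  proof -
    define y where "y = x - a"
    have "x + t *\<^sub>R e - a = y + t *\<^sub>R e" by (simp add: y_def)
    moreover have "(norm (y + t *\<^sub>R e))\<^sup>2 = (norm y)\<^sup>2 + t * (2 * (y \<bullet> e)) + t\<^sup>2 * (e \<bullet> e)"
      unfolding power2_norm_eq_inner
      by (simp add: inner_add_left inner_add_right inner_commute[of e y] power2_eq_square distrib_left)
    ultimately show ?thesis by (simp only: y_def)
  qed
  have "((\<lambda>t. g ((norm (x + t *\<^sub>R e - a))\<^sup>2)) has_real_derivative
          g1 ((norm (x + 0 *\<^sub>R e - a))\<^sup>2) * (2 * ((x - a) \<bullet> e))) (at 0)"
  proof (rule DERIV_chain2[where f = g and g = "\<lambda>t. (norm (x + t *\<^sub>R e - a))\<^sup>2"])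
    show "(g has_real_derivative g1 ((norm (x + 0 *\<^sub>R e - a))\<^sup>2)) (at ((norm (x + 0 *\<^sub>R e - a))\<^sup>2))"
      by (rule assms) simp
    show "((\<lambda>t. (norm (x + t *\<^sub>R e - a))\<^sup>2) has_real_derivative 2 * ((x - a) \<bullet> e)) (at 0)"
      unfolding eq by (auto intro!: derivative_eq_intros)
  qed
  then show ?thesis by (simp add: mult_ac)
qed

lemma continuous_on_radial:
  fixes a :: "'a::euclidean_space"
  assumes "continuous_on {0..} g"
  shows "continuous_on UNIV (\<lambda>x. g ((norm (x - a))\<^sup>2))"
  by (rule continuous_on_compose2[OF assms]) (auto intro!: continuous_intros)

lemma radial_support:
  fixes a x :: "'a::real_normed_vector"
  assumes "norm a + sqrt R < norm x" "0 \<le> R"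
  shows "R \<le> (norm (x - a))\<^sup>2"
proof -
  have "sqrt R \<le> norm (x - a)" using assms norm_triangle_sub[of x a] by linarith
  then have "(sqrt R)\<^sup>2 \<le> (norm (x - a))\<^sup>2" using assms by (intro power_mono) auto
  then show ?thesis using assms by simp
qed

text \<open>The identity \<open>\<integral> \<Delta>u v = - \<integral> \<nabla>u \<bullet> \<nabla>v\<close> for \<open>u(x) = g (\<bar>x - a\<bar>\<^sup>2)\<close> and \<open>v(x) = h (\<bar>x - z\<bar>\<^sup>2)\<close>, whose gradients are
  \<open>2 g' (x - a)\<close> and \<open>2 h' (x - z)\<close>. Allowing the compact support to come from either factor makes
  the lemma usable in both directions, which moves a Laplacian from one factor to the other.\<close>

lemma green_radial:
  fixes a z :: "'a::euclidean_space"
  assumes g: "\<And>t. 0 \<le> t \<Longrightarrow> (g has_real_derivative g1 t) (at t)"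
    and g1: "\<And>t. 0 \<le> t \<Longrightarrow> (g1 has_real_derivative g2 t) (at t)"
    and g2: "continuous_on {0..} g2"
    and h: "\<And>t. 0 \<le> t \<Longrightarrow> (h has_real_derivative h1 t) (at t)"
    and h1: "continuous_on {0..} h1"
    and R: "0 \<le> R"
    and supp: "(\<forall>t\<ge>R. g1 t = 0 \<and> g2 t = 0) \<or> (\<forall>t\<ge>R. h t = 0 \<and> h1 t = 0)"
  shows "(\<integral>x. radial_laplacian DIM('a) g1 g2 ((norm (x - a))\<^sup>2) * h ((norm (x - z))\<^sup>2) \<partial>lborel)
       = - (\<integral>x. 4 * (g1 ((norm (x - a))\<^sup>2) * h1 ((norm (x - z))\<^sup>2) * ((x - a) \<bullet> (x - z))) \<partial>lborel)"
proof -
  define A where "A x = (norm (x - a))\<^sup>2" for x :: 'a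
  define Z where "Z x = (norm (x - z))\<^sup>2" for x :: 'a
  \<comment> \<open>\<open>F e\<close> is the component of the field \<open>v \<nabla>u\<close> along \<open>e\<close>, and \<open>D e\<close> its derivative in that direction.\<close>
  define F where "F e x = 2 * ((x - a) \<bullet> e) * g1 (A x) * h (Z x)" for e x :: 'a
  define D where "D e x = 2 * (e \<bullet> e) * g1 (A x) * h (Z x)
      + 4 * ((x - a) \<bullet> e)\<^sup>2 * g2 (A x) * h (Z x)
      + 4 * ((x - a) \<bullet> e) * ((x - z) \<bullet> e) * g1 (A x) * h1 (Z x)" for e x :: 'a
  have cg1: "continuous_on {0..} g1" and ch: "continuous_on {0..} h"
    using g1 h by (auto intro!: continuous_at_imp_continuous_on DERIV_isCont)
  note conts = continuous_on_radial[OF cg1, of a, folded A_def] continuous_on_radial[OF g2, of a, folded A_def]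
    continuous_on_radial[OF ch, of z, folded Z_def] continuous_on_radial[OF h1, of z, folded Z_def]
  obtain \<rho> where \<rho>: "\<And>x. \<rho> < norm x \<Longrightarrow>
      (g1 (A x) = 0 \<and> g2 (A x) = 0) \<or> (h (Z x) = 0 \<and> h1 (Z x) = 0)"
  proof
    fix x :: 'a
    assume *: "norm a + norm z + sqrt R < norm x"
    have "norm a + sqrt R < norm x" "norm z + sqrt R < norm x"
      using * norm_ge_zero[of a] norm_ge_zero[of z] by linarith+
    then have "R \<le> A x" "R \<le> Z x"
      unfolding A_def Z_def using R by (auto intro: radial_support)
    then show "(g1 (A x) = 0 \<and> g2 (A x) = 0) \<or> (h (Z x) = 0 \<and> h1 (Z x) = 0)"
      using supp by blast
  qed
  have D0: "integral\<^sup>L lborel (D e) = 0" for e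
  proof (rule integral_directional_derivative_eq_0)
    fix x :: 'a
    have "((\<lambda>t. 2 * ((x + t *\<^sub>R e - a) \<bullet> e)) has_real_derivative 2 * (e \<bullet> e)) (at 0)"
      by (auto simp: inner_diff_left inner_add_left intro!: derivative_eq_intros)
    moreover have "((\<lambda>t. g1 ((norm (x + t *\<^sub>R e - a))\<^sup>2)) has_real_derivative
           2 * ((x - a) \<bullet> e) * g2 ((norm (x - a))\<^sup>2)) (at 0)"
      by (rule has_derivative_radial) (rule g1)
    moreover have "((\<lambda>t. h ((norm (x + t *\<^sub>R e - z))\<^sup>2)) has_real_derivative
           2 * ((x - z) \<bullet> e) * h1 ((norm (x - z))\<^sup>2)) (at 0)"
      by (rule has_derivative_radial) (rule h)
    ultimately have "((\<lambda>t. 2 * ((x + t *\<^sub>R e - a) \<bullet> e) * g1 ((norm (x + t *\<^sub>R e - a))\<^sup>2)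
        * h ((norm (x + t *\<^sub>R e - z))\<^sup>2)) has_real_derivative
        (2 * (e \<bullet> e) * g1 ((norm (x + 0 *\<^sub>R e - a))\<^sup>2)
          + 2 * ((x - a) \<bullet> e) * g2 ((norm (x - a))\<^sup>2) * (2 * ((x + 0 *\<^sub>R e - a) \<bullet> e)))
          * h ((norm (x + 0 *\<^sub>R e - z))\<^sup>2)
        + 2 * ((x - z) \<bullet> e) * h1 ((norm (x - z))\<^sup>2)
          * (2 * ((x + 0 *\<^sub>R e - a) \<bullet> e) * g1 ((norm (x + 0 *\<^sub>R e - a))\<^sup>2))) (at 0)"
      by (intro DERIV_mult)
    then
    show "((\<lambda>t. F e (x + t *\<^sub>R e)) has_real_derivative D e x) (at 0)"
      unfolding F_def A_def Z_def
    proof (rule DERIV_cong, goal_cases)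
      case 1
      have e0: "x + 0 *\<^sub>R e = x" by simp
      show ?case
        unfolding e0 D_def A_def Z_def
        by (simp add: distrib_left distrib_right power2_eq_square[of "(x - a) \<bullet> e"])
    qed
  next
    show "continuous_on UNIV (F e)" unfolding F_def by (intro continuous_intros conts)
    show "continuous_on UNIV (D e)" unfolding D_def by (intro continuous_intros conts)
    show "F e x = 0" if "\<rho> < norm x" for x using \<rho>[OF that] by (auto simp: F_def)
    show "D e x = 0" if "\<rho> < norm x" for x using \<rho>[OF that] by (auto simp: D_def)
  qed
  have int_D: "integrable lborel (D e)" for e
  proof (rule integrable_continuous_bounded_support)
    show "continuous_on UNIV (D e)" unfolding D_def by (intro continuous_intros conts)
    show "D e x = 0" if "\<rho> < norm x" for x using \<rho>[OF that] by (auto simp: D_def)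
  qed
  let ?L = "\<lambda>x. radial_laplacian DIM('a) g1 g2 (A x) * h (Z x)"
  let ?G = "\<lambda>x. 4 * (g1 (A x) * h1 (Z x) * ((x - a) \<bullet> (x - z)))"
  have sum_D: "(\<Sum>e\<in>Basis. D e x) = ?L x + ?G x" for x
  proof -
    have "(\<Sum>e\<in>Basis. D e x) = 2 * (\<Sum>e\<in>(Basis::'a set). e \<bullet> e) * g1 (A x) * h (Z x)
      + 4 * (\<Sum>e\<in>Basis. ((x - a) \<bullet> e)\<^sup>2) * g2 (A x) * h (Z x)
      + 4 * (\<Sum>e\<in>Basis. ((x - a) \<bullet> e) * ((x - z) \<bullet> e)) * g1 (A x) * h1 (Z x)"
      unfolding D_def by (simp add: sum.distrib sum_distrib_left sum_distrib_right mult_ac)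
    moreover have "(\<Sum>e\<in>(Basis::'a set). e \<bullet> e) = DIM('a)" by (simp add: inner_same_Basis)
    moreover have "(\<Sum>e\<in>Basis. ((x - a) \<bullet> e) * ((x - z) \<bullet> e)) = (x - a) \<bullet> (x - z)"
      by (rule euclidean_inner[symmetric])
    moreover have "(\<Sum>e\<in>Basis. ((x - a) \<bullet> e)\<^sup>2) = A x"
      unfolding A_def power2_norm_eq_inner by (subst euclidean_inner) (simp add: power2_eq_square)
    ultimately show ?thesis
      by (simp only: radial_laplacian_def) (simp add: distrib_left distrib_right mult_ac)
  qed
  have int: "integrable lborel ?L" "integrable lborel ?G"
  proof -
    have cA: "continuous_on UNIV A" unfolding A_def by (intro continuous_intros)
    show "integrable lborel ?L"
    proof (rule integrable_continuous_bounded_support)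
      show "continuous_on UNIV ?L"
        unfolding radial_laplacian_def by (intro continuous_intros conts cA)
      show "?L x = 0" if "\<rho> < norm x" for x
        using \<rho>[OF that] by (auto simp: radial_laplacian_def)
    qed
    show "integrable lborel ?G"
    proof (rule integrable_continuous_bounded_support)
      show "continuous_on UNIV ?G" by (intro continuous_intros conts)
      show "?G x = 0" if "\<rho> < norm x" for x using \<rho>[OF that] by auto
    qed
  qed
  have "integral\<^sup>L lborel ?L + integral\<^sup>L lborel ?G = (\<integral>x. (\<Sum>e\<in>Basis. D e x) \<partial>lborel)"
    unfolding sum_D using int by simp
  also have "\<dots> = 0" using int_D D0 by (subst Bochner_Integration.integral_sum) auto
  finally show ?thesis unfolding A_def Z_def by linarith
qed

section \<open>Iterated Laplacians of powers of an affine function\<close>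

text \<open>For the powers \<open>p i t = (c + \<epsilon> t)\<^bsup>s - i\<^esup>\<close> with \<open>\<epsilon> = \<plusminus>1\<close>, the \<open>k\<close>-th iterated Laplacian of \<open>p 0\<close> has the
  profile \<open>\<Sum>j\<le>k. iter_coeff d \<epsilon> c s k j * p (k + j)\<close>.\<close>

definition iter_coeff :: "real \<Rightarrow> real \<Rightarrow> real \<Rightarrow> real \<Rightarrow> nat \<Rightarrow> nat \<Rightarrow> real" where
  "iter_coeff d \<epsilon> c s k j = (4 * \<epsilon>) ^ k * (- c) ^ j * real (k choose j)
     * (\<Prod>i<k + j. s - real i) * (\<Prod>i\<in>{j<..k}. s + d / 2 - real i)"

text \<open>The \<open>n\<close>-th derivative of the profile of the \<open>k\<close>-th iterated Laplacian: the inner product over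
  \<open>i < n\<close> is produced by differentiating \<open>p (k + j)\<close>.\<close>

definition iter_profile :: "real \<Rightarrow> real \<Rightarrow> real \<Rightarrow> real \<Rightarrow> (nat \<Rightarrow> real \<Rightarrow> real) \<Rightarrow> nat \<Rightarrow> nat \<Rightarrow> real \<Rightarrow> real" where
  "iter_profile d \<epsilon> c s p n k t = (\<Sum>j\<le>k. iter_coeff d \<epsilon> c s k j *
     ((\<epsilon> ^ n * (\<Prod>i<n. s - real (k + j + i))) * p (k + j + n) t))"

text \<open>The two properties of the powers \<open>(c + \<epsilon> t)\<^bsup>s - i\<^esup>\<close> on which the computation of Laplacians rests:
  differentiation lowers the exponent by one, and multiplication by \<open>t = \<epsilon> ((c + \<epsilon> t) - c)\<close> can be
  traded for raising it. The bound \<open>M\<close> is there for the truncated powers, which stop being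
  differentiable once the exponent gets small.\<close>

definition power_ladder :: "real \<Rightarrow> real \<Rightarrow> real \<Rightarrow> nat \<Rightarrow> (nat \<Rightarrow> real \<Rightarrow> real) \<Rightarrow> bool" where
  "power_ladder \<epsilon> c s M p \<longleftrightarrow> \<epsilon>\<^sup>2 = 1 \<and>
     (\<forall>i<M. \<forall>t\<ge>0. (p i has_real_derivative \<epsilon> * (s - real i) * p (Suc i) t) (at t)) \<and>
     (\<forall>i<M. \<forall>t\<ge>0. t * p (Suc i) t = \<epsilon> * (p i t - c * p (Suc i) t)) \<and>
     (\<forall>i\<le>M. continuous_on {0..} (p i))"

text \<open>One Laplacian sends \<open>p i\<close> to a multiple of \<open>p (i + 1)\<close> plus a multiple of \<open>p (i + 2)\<close>, so each new
  coefficient collects two old ones. After cancelling common factors the recursion says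
  \<open>(A - k - 1) C(k+1, j+1) = (A - k - j - 2) C(k, j+1) + (A - j - 1) C(k, j)\<close> with \<open>A = s + d/2\<close>, where
  \<open>C\<close> denotes binomial coefficients; this is absorption combined with Pascal's rule.\<close>

lemma iter_coeff_Suc:
  assumes "j \<le> k"
  shows "iter_coeff d \<epsilon> c s (Suc k) (Suc j) =
     4 * \<epsilon> * (s - real (k + Suc j)) * (s + d / 2 - 1 - real (k + Suc j)) * iter_coeff d \<epsilon> c s k (Suc j)
     - 4 * \<epsilon> * c * (s - real (k + j)) * (s - real (k + j) - 1) * iter_coeff d \<epsilon> c s k j"
proof -
  \<comment> \<open>\<open>Q\<close> and \<open>B\<close> are the factors shared by the three coefficients.\<close>
  define Q where "Q = (4 * \<epsilon>) ^ k * (- c) ^ Suc j * (\<Prod>i<k + j. s - real i) * (s - real (k + j)) * (s - real (k + Suc j))"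
  define B where "B = (\<Prod>i\<in>{Suc j<..k}. s + d / 2 - real i)"
  define A where "A = s + d / 2"
  have pr: "(\<Prod>i<Suc k + Suc j. s - real i) = (\<Prod>i<k + j. s - real i) * (s - real (k + j)) * (s - real (k + Suc j))"
    by simp
  have choose: "real (Suc j) * real (k choose Suc j) = (real k - real j) * real (k choose j)"
  proof -
    have "Suc j * (k choose Suc j) = (k - j) * (k choose j)"
      by (simp only: binomial_absorption binomial_absorb_comp)
    then have "real (Suc j * (k choose Suc j)) = real ((k - j) * (k choose j))" by (simp only:)
    then show ?thesis using assms by (simp only: of_nat_mult of_nat_diff)
  qed
  show ?thesis
  proof (cases "j = k")
    case True
    have P: "(\<Prod>i<Suc k + Suc k. s - real i) = (\<Prod>i<k + k. s - real i) * (s - real (k + k)) * (s - real (k + k) - 1)"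
      by (simp add: algebra_simps)
    show ?thesis
      unfolding True iter_coeff_def P by (simp add: binomial_eq_0)
  next
    case False
    then have jk: "Suc j \<le> k" using assms by simp
    have s1: "{Suc j<..Suc k} = insert (Suc k) {Suc j<..k}" using jk by auto
    have s2: "{j<..k} = insert (Suc j) {Suc j<..k}" using jk by auto
    have C1: "iter_coeff d \<epsilon> c s (Suc k) (Suc j) = 4 * \<epsilon> * Q * B * ((A - real (Suc k)) * real (Suc k choose Suc j))"
      unfolding iter_coeff_def s1 pr Q_def B_def A_def by (subst prod.insert) (auto simp: mult_ac)
    have C2: "(s - real (k + Suc j)) * iter_coeff d \<epsilon> c s k (Suc j) = Q * B * real (k choose Suc j)"
      unfolding iter_coeff_def Q_def B_def by simp
    have C3: "c * (s - real (k + j)) * (s - real (k + j) - 1) * iter_coeff d \<epsilon> c s k j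
       = - (Q * B * ((A - real (Suc j)) * real (k choose j)))"
    proof -
      have "s - real (k + j) - 1 = s - real (k + Suc j)" by simp
      then show ?thesis
        unfolding iter_coeff_def Q_def s2 B_def A_def
        by (subst prod.insert) (simp_all add: mult_ac del: of_nat_add of_nat_Suc)
    qed
    have X: "(A - real (Suc k)) * real (Suc k choose Suc j) = (A - 1 - real (k + Suc j)) * real (k choose Suc j)
            + (A - real (Suc j)) * real (k choose j)"
      using choose by (simp add: algebra_simps)
    have "iter_coeff d \<epsilon> c s (Suc k) (Suc j) = 4 * \<epsilon> * (A - 1 - real (k + Suc j)) * (Q * B * real (k choose Suc j))
      - 4 * \<epsilon> * (- (Q * B * ((A - real (Suc j)) * real (k choose j))))"
      unfolding C1 X by (simp only: distrib_left distrib_right diff_conv_add_uminus mult_minus_right minus_minus mult_ac)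
    then show ?thesis unfolding C2[symmetric] C3[symmetric] by (simp only: A_def mult_ac)
  qed
qed

lemma iter_coeff_Suc_0:
  "iter_coeff d \<epsilon> c s (Suc k) 0 =
     4 * \<epsilon> * (s - real k) * (s + d / 2 - 1 - real k) * iter_coeff d \<epsilon> c s k 0"
proof -
  have "{0<..Suc k} = insert (Suc k) {0<..k}" by auto
  then show ?thesis unfolding iter_coeff_def by (simp add: algebra_simps)
qed

lemma iter_coeff_eq_0: "k < j \<Longrightarrow> iter_coeff d \<epsilon> c s k j = 0"
  by (simp add: iter_coeff_def)

lemma iter_profile_has_derivative:
  assumes "power_ladder \<epsilon> c s M p" "2 * k + n < M" "0 \<le> t"
  shows "(iter_profile d \<epsilon> c s p n k has_real_derivative iter_profile d \<epsilon> c s p (Suc n) k t) (at t)"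
proof -
  have "((\<lambda>t. \<Sum>j\<le>k. iter_coeff d \<epsilon> c s k j * ((\<epsilon> ^ n * (\<Prod>i<n. s - real (k + j + i))) * p (k + j + n) t))
     has_real_derivative (\<Sum>j\<le>k. iter_coeff d \<epsilon> c s k j * ((\<epsilon> ^ n * (\<Prod>i<n. s - real (k + j + i)))
        * (\<epsilon> * (s - real (k + j + n)) * p (Suc (k + j + n)) t)))) (at t)"
    using assms by (intro DERIV_sum DERIV_cmult) (auto simp: power_ladder_def simp del: of_nat_add)
  moreover have "(\<lambda>t. \<Sum>j\<le>k. iter_coeff d \<epsilon> c s k j * ((\<epsilon> ^ n * (\<Prod>i<n. s - real (k + j + i))) * p (k + j + n) t)) = iter_profile d \<epsilon> c s p n k"
    by (simp add: iter_profile_def fun_eq_iff)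
  moreover have "(\<Sum>j\<le>k. iter_coeff d \<epsilon> c s k j * ((\<epsilon> ^ n * (\<Prod>i<n. s - real (k + j + i)))
        * (\<epsilon> * (s - real (k + j + n)) * p (Suc (k + j + n)) t))) = iter_profile d \<epsilon> c s p (Suc n) k t"
    unfolding iter_profile_def by (intro sum.cong) (auto simp: mult_ac)
  ultimately show ?thesis by simp
qed

lemma continuous_on_iter_profile:
  assumes "power_ladder \<epsilon> c s M p" "2 * k + n \<le> M"
  shows "continuous_on {0..} (iter_profile d \<epsilon> c s p n k)"
  unfolding iter_profile_def using assms
  by (intro continuous_intros) (auto simp: power_ladder_def)

lemma radial_laplacian_iter_profile:
  assumes p: "power_ladder \<epsilon> c s M p" and k: "2 * k + 2 \<le> M" and t: "0 \<le> t"
  shows "radial_laplacian d (iter_profile d \<epsilon> c s p 1 k) (iter_profile d \<epsilon> c s p 2 k) t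
       = iter_profile d \<epsilon> c s p 0 (Suc k) t"
proof -
  let ?a = "iter_coeff d \<epsilon> c s k" and ?b = "iter_coeff d \<epsilon> c s (Suc k)"
  let ?u = "\<lambda>j. 4 * \<epsilon> * (s - real (k + j)) * (s + d / 2 - 1 - real (k + j)) * ?a j"
  let ?v = "\<lambda>j. 4 * \<epsilon> * c * (s - real (k + j)) * (s - real (k + j) - 1) * ?a j"
  have e2: "\<epsilon> * \<epsilon> = 1" using p by (simp add: power_ladder_def power2_eq_square)
  have summand: "2 * d * (?a j * ((\<epsilon> ^ 1 * (\<Prod>i<1. s - real (k + j + i))) * p (k + j + 1) t))
      + 4 * t * (?a j * ((\<epsilon> ^ 2 * (\<Prod>i<2. s - real (k + j + i))) * p (k + j + 2) t))
      = ?u j * p (Suc (k + j)) t - ?v j * p (Suc (Suc (k + j))) t" if "j \<le> k" for j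
  proof -
    have tp: "t * p (Suc (Suc (k + j))) t = \<epsilon> * (p (Suc (k + j)) t - c * p (Suc (Suc (k + j))) t)"
      using p t that k by (auto simp: power_ladder_def)
    have "4 * t * (?a j * ((\<epsilon> ^ 2 * (\<Prod>i<2. s - real (k + j + i))) * p (k + j + 2) t))
      = 4 * ?a j * (s - real (k + j)) * (s - real (k + j) - 1) * (t * p (Suc (Suc (k + j))) t)"
      using e2 by (simp add: numeral_2_eq_2 mult_ac algebra_simps)
    also have "\<dots> = 4 * ?a j * (s - real (k + j)) * (s - real (k + j) - 1) * (\<epsilon> * (p (Suc (k + j)) t - c * p (Suc (Suc (k + j))) t))"
      unfolding tp ..
    finally show ?thesis by (simp add: algebra_simps)
  qed
  have "radial_laplacian d (iter_profile d \<epsilon> c s p 1 k) (iter_profile d \<epsilon> c s p 2 k) t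
     = (\<Sum>j\<le>k. ?u j * p (Suc (k + j)) t - ?v j * p (Suc (Suc (k + j))) t)"
    unfolding radial_laplacian_def iter_profile_def sum_distrib_left sum.distrib[symmetric]
    by (intro sum.cong) (auto simp only: summand atMost_iff)
  also have "\<dots> = (\<Sum>j\<le>Suc k. ?u j * p (Suc (k + j)) t) - (\<Sum>j\<le>k. ?v j * p (Suc (Suc (k + j))) t)"
    by (simp add: sum_subtractf iter_coeff_eq_0)
  also have "(\<Sum>j\<le>Suc k. ?u j * p (Suc (k + j)) t)
      = ?u 0 * p (Suc k) t + (\<Sum>j\<le>k. ?u (Suc j) * p (Suc (k + Suc j)) t)"
    by (subst sum.atMost_Suc_shift) simp
  also have "?u 0 * p (Suc k) t + (\<Sum>j\<le>k. ?u (Suc j) * p (Suc (k + Suc j)) t) - (\<Sum>j\<le>k. ?v j * p (Suc (Suc (k + j))) t)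
      = ?b 0 * p (Suc k) t + (\<Sum>j\<le>k. ?b (Suc j) * p (Suc (k + Suc j)) t)"
  proof -
    have "?b 0 = ?u 0" by (simp add: iter_coeff_Suc_0)
    moreover have "?b (Suc j) * p (Suc (k + Suc j)) t = ?u (Suc j) * p (Suc (k + Suc j)) t - ?v j * p (Suc (Suc (k + j))) t"
      if "j \<le> k" for j
      unfolding iter_coeff_Suc[OF that] by (simp add: left_diff_distrib)
    then have "(\<Sum>j\<le>k. ?b (Suc j) * p (Suc (k + Suc j)) t) =
       (\<Sum>j\<le>k. ?u (Suc j) * p (Suc (k + Suc j)) t) - (\<Sum>j\<le>k. ?v j * p (Suc (Suc (k + j))) t)"
      unfolding sum_subtractf[symmetric] by (intro sum.cong) auto
    ultimately show ?thesis by simp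
  qed
  also have "\<dots> = (\<Sum>j\<le>Suc k. ?b j * p (Suc (k + j)) t)"
    by (subst sum.atMost_Suc_shift) simp
  also have "\<dots> = iter_profile d \<epsilon> c s p 0 (Suc k) t"
    by (simp add: iter_profile_def)
  finally show ?thesis .
qed

text \<open>When \<open>s + d/2 = m\<close>, the last product in \<open>iter_coeff\<close> contains the factor \<open>s + d/2 - m = 0\<close> unless \<open>j = m\<close>.
  For \<open>s = 1/2\<close> this is the case \<open>d = 2 m - 1\<close>.\<close>

lemma iter_profile_critical:
  assumes "s + d / 2 = real m"
  shows "iter_profile d \<epsilon> c s p 0 m t = (4 * \<epsilon>) ^ m * (- c) ^ m * (\<Prod>i<2 * m. s - real i) * p (2 * m) t"
proof -
  have "iter_coeff d \<epsilon> c s m j = 0" if "j < m" for j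
    unfolding iter_coeff_def using assms that by auto
  then have "(\<Sum>j\<le>m. iter_coeff d \<epsilon> c s m j * p (m + j) t) = iter_coeff d \<epsilon> c s m m * p (m + m) t"
    by (subst sum.remove[of _ m]) (auto intro!: sum.neutral)
  then show ?thesis by (simp add: iter_profile_def iter_coeff_def mult_2)
qed

section \<open>Bumps and regularised norms as ladders\<close>

lemma has_derivative_truncated_power:
  assumes "2 \<le> n"
  shows "((\<lambda>t. (max 0 (R - t)) ^ n) has_real_derivative - real n * (max 0 (R - t)) ^ (n - 1)) (at (t::real))"
proof -
  consider "t < R" | "t > R" | "t = R" by linarith
  then show ?thesis
  proof cases
    case 1
    have "((\<lambda>t. (R - t) ^ n) has_real_derivative - real n * (R - t) ^ (n - 1)) (at t)"
      by (auto intro!: derivative_eq_intros)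
    then have "((\<lambda>t. (max 0 (R - t)) ^ n) has_real_derivative - real n * (R - t) ^ (n - 1)) (at t)"
      by (rule has_field_derivative_transform_within_open[where S = "{..<R}"]) (use 1 in auto)
    then show ?thesis using 1 by simp
  next
    case 2
    have "((\<lambda>t::real. 0::real) has_real_derivative 0) (at t)" by simp
    then have "((\<lambda>t. (max 0 (R - t)) ^ n) has_real_derivative 0) (at t)"
      by (rule has_field_derivative_transform_within_open[where S = "{R<..}"]) (use 2 assms in auto)
    then show ?thesis using 2 assms by (simp add: power_0_left)
  next
    case 3
    have "((\<lambda>x. ((max 0 (R - x)) ^ n - (max 0 (R - R)) ^ n) / (x - R)) \<longlongrightarrow> 0) (at R)"
    proof (rule Lim_null_comparison)
      have "norm (((max 0 (R - x)) ^ n - (max 0 (R - R)) ^ n) / (x - R)) \<le> \<bar>x - R\<bar> ^ (n - 1)" if "x \<noteq> R" for x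
      proof -
        have "\<bar>(max 0 (R - x)) ^ n\<bar> \<le> \<bar>x - R\<bar> ^ n"
          by (simp add: power_abs abs_le_iff) (intro power_mono, auto)
        also have "\<dots> = \<bar>x - R\<bar> * \<bar>x - R\<bar> ^ (n - 1)" using assms by (cases n) auto
        finally show ?thesis using that assms by (simp add: power_0_left divide_simps mult.commute)
      qed
      then show "\<forall>\<^sub>F x in at R. norm (((max 0 (R - x)) ^ n - (max 0 (R - R)) ^ n) / (x - R)) \<le> \<bar>x - R\<bar> ^ (n - 1)"
        by (auto simp: eventually_at_filter)
      have "((\<lambda>x. \<bar>x - R\<bar> ^ (n - 1)) \<longlongrightarrow> \<bar>R - R\<bar> ^ (n - 1)) (at R)"
        by (intro tendsto_intros)
      then show "((\<lambda>x. \<bar>x - R\<bar> ^ (n - 1)) \<longlongrightarrow> 0) (at R)" using assms by (simp add: power_0_left)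
    qed
    then show ?thesis using 3 assms by (simp add: has_field_derivative_iff power_0_left)
  qed
qed

lemma power_ladder_truncated:
  assumes "M + 2 \<le> N"
  shows "power_ladder (-1) R (real N) M (\<lambda>i t. (max 0 (R - t)) ^ (N - i))"
  unfolding power_ladder_def
proof (intro conjI allI impI)
  fix i and t :: real assume i: "i < M"
  have "2 \<le> N - i" and e: "N - i - 1 = N - Suc i" and Ni: "real (N - i) = real N - real i"
    using i assms by (auto simp: of_nat_diff)
  with has_derivative_truncated_power[of "N - i" R t]
  show "((\<lambda>t. (max 0 (R - t)) ^ (N - i)) has_real_derivative
           - 1 * (real N - real i) * (max 0 (R - t)) ^ (N - Suc i)) (at t)"
    by simp
  have e2: "N - i = Suc (N - Suc i)" using i assms by linarith
  have pos: "N - Suc i \<noteq> 0" using i assms by linarith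
  show "t * (max 0 (R - t)) ^ (N - Suc i) =
          - 1 * ((max 0 (R - t)) ^ (N - i) - R * (max 0 (R - t)) ^ (N - Suc i))"
    unfolding e2 using pos by (cases "t \<le> R") (auto simp: algebra_simps power_0_left)
next
  show "continuous_on {0..} (\<lambda>t. (max 0 (R - t)) ^ (N - i))" for i
    by (intro continuous_intros)
qed simp

lemma power_ladder_powr:
  assumes "0 < c"
  shows "power_ladder 1 c s M (\<lambda>i t. (c + t) powr (s - real i))"
  unfolding power_ladder_def
proof (intro conjI allI impI)
  fix i and t :: real assume t: "0 \<le> t"
  then have ct: "0 < c + t" using assms by simp
  have e: "s - real (Suc i) = s - real i - 1" by simp
  show "((\<lambda>t. (c + t) powr (s - real i)) has_real_derivative 1 * (s - real i) * (c + t) powr (s - real (Suc i))) (at t)"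
    unfolding e using ct by (auto intro!: derivative_eq_intros)
  have "(c + t) powr (s - real i) = (c + t) * (c + t) powr (s - real (Suc i))"
    unfolding e using ct by (simp add: powr_diff)
  then show "t * (c + t) powr (s - real (Suc i)) = 1 * ((c + t) powr (s - real i) - c * (c + t) powr (s - real (Suc i)))"
    by (simp add: algebra_simps)
next
  show "continuous_on {0..} (\<lambda>t. (c + t) powr (s - real i))" for i
    using assms by (intro continuous_intros) auto
qed simp

lemma iter_profile_support:
  assumes "\<And>i t. i \<le> M \<Longrightarrow> R \<le> t \<Longrightarrow> p i t = 0" "2 * k + n \<le> M" "R \<le> t"
  shows "iter_profile d \<epsilon> c s p n k t = 0"
  unfolding iter_profile_def using assms by (intro sum.neutral) auto

section \<open>Moving iterated Laplacians between the factors\<close>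

text \<open>Both the Laplacian on the first factor and the Laplacian on the second are equal to the same
  integral of the product of gradients.\<close>

lemma green_iter_profile:
  fixes a z :: "'a::euclidean_space"
  defines "d \<equiv> real DIM('a)"
  assumes p: "power_ladder \<epsilon> c s M p" and q: "power_ladder \<epsilon>' c' s' M' q"
    and k: "2 * k + 2 \<le> M" and l: "2 * l + 2 \<le> M'"
    and supp: "\<And>i t. i \<le> M \<Longrightarrow> R \<le> t \<Longrightarrow> p i t = 0" and R: "0 \<le> R"
  shows "(\<integral>x. iter_profile d \<epsilon> c s p 0 (Suc k) ((norm (x - a))\<^sup>2) * iter_profile d \<epsilon>' c' s' q 0 l ((norm (x - z))\<^sup>2) \<partial>lborel)
       = - (\<integral>x. 4 * (iter_profile d \<epsilon> c s p 1 k ((norm (x - a))\<^sup>2) * iter_profile d \<epsilon>' c' s' q 1 l ((norm (x - z))\<^sup>2) * ((x - a) \<bullet> (x - z))) \<partial>lborel)" (is "?I1 = ?J")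
    and "(\<integral>x. iter_profile d \<epsilon> c s p 0 k ((norm (x - a))\<^sup>2) * iter_profile d \<epsilon>' c' s' q 0 (Suc l) ((norm (x - z))\<^sup>2) \<partial>lborel)
       = - (\<integral>x. 4 * (iter_profile d \<epsilon> c s p 1 k ((norm (x - a))\<^sup>2) * iter_profile d \<epsilon>' c' s' q 1 l ((norm (x - z))\<^sup>2) * ((x - a) \<bullet> (x - z))) \<partial>lborel)" (is "?I2 = ?J")
proof -
  have dp: "\<And>t. 0 \<le> t \<Longrightarrow> (iter_profile d \<epsilon> c s p n k has_real_derivative iter_profile d \<epsilon> c s p (Suc n) k t) (at t)" if "n < 2" for n
    using p k that by (intro iter_profile_has_derivative[where M = M]) auto
  have dq: "\<And>t. 0 \<le> t \<Longrightarrow> (iter_profile d \<epsilon>' c' s' q n l has_real_derivative iter_profile d \<epsilon>' c' s' q (Suc n) l t) (at t)" if "n < 2" for n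
    using q l that by (intro iter_profile_has_derivative[where M = M']) auto
  have cp: "continuous_on {0..} (iter_profile d \<epsilon> c s p n k)" if "n \<le> 2" for n
    using p k that by (intro continuous_on_iter_profile[where M = M]) auto
  have cq: "continuous_on {0..} (iter_profile d \<epsilon>' c' s' q n l)" if "n \<le> 2" for n
    using q l that by (intro continuous_on_iter_profile[where M = M']) auto
  have sp: "iter_profile d \<epsilon> c s p n k t = 0" if "n \<le> 2" "R \<le> t" for n t
    using supp k that by (intro iter_profile_support[where M = M and R = R]) auto
  have "?I1 = (\<integral>x. radial_laplacian DIM('a) (iter_profile d \<epsilon> c s p 1 k) (iter_profile d \<epsilon> c s p 2 k) ((norm (x - a))\<^sup>2)
       * iter_profile d \<epsilon>' c' s' q 0 l ((norm (x - z))\<^sup>2) \<partial>lborel)"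
    unfolding d_def by (subst radial_laplacian_iter_profile[OF p k]) auto
  also have "\<dots> = ?J"
    by (rule green_radial[where R = R and g = "iter_profile d \<epsilon> c s p 0 k"])
       (use dp[of 0] dp[of 1] dq[of 0] cp[of 2] cq[of 1] sp[of 1] sp[of 2] R in \<open>auto simp: numeral_2_eq_2\<close>)
  finally show "?I1 = ?J" .
  have "?I2 = (\<integral>x. radial_laplacian DIM('a) (iter_profile d \<epsilon>' c' s' q 1 l) (iter_profile d \<epsilon>' c' s' q 2 l) ((norm (x - z))\<^sup>2)
       * iter_profile d \<epsilon> c s p 0 k ((norm (x - a))\<^sup>2) \<partial>lborel)"
    unfolding d_def by (subst radial_laplacian_iter_profile[OF q l]) (auto simp: mult.commute)
  also have "\<dots> = - (\<integral>x. 4 * (iter_profile d \<epsilon>' c' s' q 1 l ((norm (x - z))\<^sup>2) * iter_profile d \<epsilon> c s p 1 k ((norm (x - a))\<^sup>2) * ((x - z) \<bullet> (x - a))) \<partial>lborel)"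
    by (rule green_radial[where R = R and g = "iter_profile d \<epsilon>' c' s' q 0 l"])
       (use dp[of 0] dq[of 1] dq[of 0] cp[of 1] cq[of 2] sp[of 0] sp[of 1] R in \<open>auto simp: numeral_2_eq_2\<close>)
  also have "\<dots> = ?J" by (simp add: mult_ac inner_commute)
  finally show "?I2 = ?J" .
qed

lemma iter_profile_adjoint:
  fixes a z :: "'a::euclidean_space"
  defines "d \<equiv> real DIM('a)"
  assumes p: "power_ladder \<epsilon> c s M p" and q: "power_ladder \<epsilon>' c' s' M' q"
    and m: "2 * m \<le> M" "2 * m \<le> M'"
    and supp: "\<And>i t. i \<le> M \<Longrightarrow> R \<le> t \<Longrightarrow> p i t = 0" and R: "0 \<le> R"
  shows "(\<integral>x. iter_profile d \<epsilon> c s p 0 m ((norm (x - a))\<^sup>2) * iter_profile d \<epsilon>' c' s' q 0 0 ((norm (x - z))\<^sup>2) \<partial>lborel)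
       = (\<integral>x. iter_profile d \<epsilon> c s p 0 0 ((norm (x - a))\<^sup>2) * iter_profile d \<epsilon>' c' s' q 0 m ((norm (x - z))\<^sup>2) \<partial>lborel)"
proof -
  let ?I = "\<lambda>k l. \<integral>x. iter_profile d \<epsilon> c s p 0 k ((norm (x - a))\<^sup>2) * iter_profile d \<epsilon>' c' s' q 0 l ((norm (x - z))\<^sup>2) \<partial>lborel"
  have "j \<le> m \<Longrightarrow> ?I m 0 = ?I (m - j) j" for j
  proof (induction j)
    case (Suc j)
    have k: "2 * (m - Suc j) + 2 \<le> M" and l: "2 * j + 2 \<le> M'" and e: "m - j = Suc (m - Suc j)"
      using m Suc.prems by auto
    have "?I (m - j) j = ?I (m - Suc j) (Suc j)"
      unfolding e d_def
      by (simp only: green_iter_profile(1)[OF p q k l supp R] green_iter_profile(2)[OF p q k l supp R])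
    then show ?case using Suc by simp
  qed simp
  from this[of m] show ?thesis by simp
qed

section \<open>The regularised norm inverts the iterated gradient\<close>

lemma lborel_integral_affine:
  fixes f :: "'a::euclidean_space \<Rightarrow> real"
  assumes "c \<noteq> 0" and [measurable]: "f \<in> borel_measurable borel"
  shows "integral\<^sup>L lborel f = \<bar>c\<bar> ^ DIM('a) * (\<integral>x. f (t + c *\<^sub>R x) \<partial>lborel)"
proof -
  have "integral\<^sup>L lborel f = integral\<^sup>L (density (distr lborel borel (\<lambda>x. t + c *\<^sub>R x)) (\<lambda>_. ennreal (\<bar>c\<bar> ^ DIM('a)))) f"
    using assms(1) by (subst lborel_affine[of c t]) simp_all
  also have "\<dots> = (\<integral>x. \<bar>c\<bar> ^ DIM('a) *\<^sub>R f x \<partial>distr lborel borel (\<lambda>x. t + c *\<^sub>R x))"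
    by (subst integral_density) auto
  also have "\<dots> = (\<integral>x. \<bar>c\<bar> ^ DIM('a) *\<^sub>R f (t + c *\<^sub>R x) \<partial>lborel)"
    by (subst integral_distr) auto
  finally show ?thesis by simp
qed

text \<open>The bound \<open>(1 + \<bar>y\<bar>\<^sup>2)\<^bsup>-d\<^esup> \<le> \<Prod>\<^sub>b (1 + y\<^sub>b\<^sup>2)\<^bsup>-1\<^esup>\<close> reduces integrability to dimension one, without polar
  coordinates.\<close>

lemma integrable_japanese_bracket:
  assumes s: "s \<le> - real DIM('a::euclidean_space)"
  shows "integrable lborel (\<lambda>y::'a. (1 + (norm y)\<^sup>2) powr s)"
proof (rule Bochner_Integration.integrable_bound)
  have "integrable lborel (\<lambda>x::real. inverse (1 + x\<^sup>2))"
    using integrable_inverse_1_plus_square by (simp add: set_integrable_def)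
  then have fin: "(\<integral>\<^sup>+x. ennreal (inverse (1 + x\<^sup>2)) \<partial>lborel) < \<infinity>"
    by (simp add: integrable_iff_bounded)
  show "integrable lborel (\<lambda>y::'a. \<Prod>b\<in>Basis. inverse (1 + (y \<bullet> b)\<^sup>2))"
    unfolding integrable_iff_bounded
  proof
    have "(\<integral>\<^sup>+y. ennreal (norm (\<Prod>b\<in>Basis. inverse (1 + (y \<bullet> b)\<^sup>2))) \<partial>(lborel :: 'a measure))
       = (\<integral>\<^sup>+y. (\<Prod>b\<in>Basis. ennreal (inverse (1 + (y \<bullet> b)\<^sup>2))) \<partial>(lborel :: 'a measure))"
      by (intro nn_integral_cong) (simp add: prod_ennreal prod_nonneg abs_prod)
    also have "\<dots> = (\<Prod>b\<in>(Basis::'a set). \<integral>\<^sup>+x. ennreal (inverse (1 + x\<^sup>2)) \<partial>lborel)"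
      by (rule nn_integral_lborel_prod) auto
    also have "\<dots> < \<infinity>" using fin by (simp add: ennreal_prod_eq_top power_less_top_ennreal)
    finally show "(\<integral>\<^sup>+y. ennreal (norm (\<Prod>b\<in>Basis. inverse (1 + (y \<bullet> b)\<^sup>2))) \<partial>(lborel :: 'a measure)) < \<infinity>" .
  qed measurable
  have "norm ((1 + (norm y)\<^sup>2) powr s) \<le> norm (\<Prod>b\<in>Basis. inverse (1 + (y \<bullet> b)\<^sup>2))" for y :: 'a
  proof -
    have "(1 + (norm y)\<^sup>2) powr s \<le> (1 + (norm y)\<^sup>2) powr (- real DIM('a))"
      using s by (intro powr_mono) auto
    also have "\<dots> = inverse ((1 + (norm y)\<^sup>2) ^ DIM('a))"
      by (simp add: powr_minus powr_realpow add_pos_nonneg)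
    also have "\<dots> = (\<Prod>b\<in>(Basis::'a set). inverse (1 + (norm y)\<^sup>2))"
      by (simp add: power_inverse)
    also have "\<dots> \<le> (\<Prod>b\<in>Basis. inverse (1 + (y \<bullet> b)\<^sup>2))"
    proof (intro prod_mono conjI le_imp_inverse_le)
      fix b :: 'a assume "b \<in> Basis"
      then have "\<bar>y \<bullet> b\<bar> \<le> norm y" by (rule Basis_le_norm)
      then show "1 + (y \<bullet> b)\<^sup>2 \<le> 1 + (norm y)\<^sup>2" by (simp add: abs_le_square_iff[symmetric])
    qed (auto intro: add_pos_nonneg)
    finally show ?thesis by (simp add: abs_prod)
  qed
  then show "AE y::'a in lborel. norm ((1 + (norm y)\<^sup>2) powr s) \<le> norm (\<Prod>b\<in>Basis. inverse (1 + (y \<bullet> b)\<^sup>2))"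
    by simp
qed measurable

text \<open>Apart from the last integration by parts, which is undone so that only the gradient of the
  regularised norm occurs, this is \<open>\<integral> \<Delta>\<^sup>m u v = \<integral> u \<Delta>\<^sup>m v\<close> for a bump \<open>u\<close> around \<open>a\<close> and the regularised
  norm \<open>v(x) = (c + \<bar>x - z\<bar>\<^sup>2)\<^bsup>1/2\<^esup>\<close>. The exponent \<open>2 m + 2\<close> of the bump is large enough for all \<open>m\<close>
  Laplacians to be continuous.\<close>

lemma regularised_kernel_identity:
  fixes a z :: "'a::euclidean_space"
  assumes m: "DIM('a) + 1 = 2 * m" and c: "0 < c" and R: "0 \<le> R"
  defines "G \<equiv> iter_profile (real DIM('a)) (-1) R (real (2 * m + 2)) (\<lambda>i t. (max 0 (R - t)) ^ (2 * m + 2 - i)) 1 (m - 1)"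
  shows "(\<integral>x. - 2 * G ((norm (x - a))\<^sup>2) * ((x - a) \<bullet> (x - z)) * (c + (norm (x - z))\<^sup>2) powr (-1/2) \<partial>lborel)
    = (4 ^ m * (- 1) ^ m * (\<Prod>i<2 * m. 1/2 - real i)) *
      (c ^ m * (\<integral>x. (max 0 (R - (norm (x - a))\<^sup>2)) ^ (2 * m + 2) * (c + (norm (x - z))\<^sup>2) powr (1/2 - real (2 * m)) \<partial>lborel))"
    (is "?L = ?K * (c ^ m * ?J)")
proof -
  define p where "p = (\<lambda>i t. (max 0 (R - t)) ^ (2 * m + 2 - i))"
  define q where "q = (\<lambda>i t. (c + t) powr (1/2 - real i))"
  let ?d = "real DIM('a)" and ?N = "real (2 * m + 2)"
  have p: "power_ladder (-1) R ?N (2 * m) p"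
    unfolding p_def by (rule power_ladder_truncated) simp
  have q: "power_ladder 1 c (1/2) (2 * m) q"
    unfolding q_def by (rule power_ladder_powr) (rule c)
  have supp: "p i t = 0" if "i \<le> 2 * m" "R \<le> t" for i t
    unfolding p_def using that by (auto simp: power_0_left)
  have m1: "1 \<le> m" using m DIM_positive[where 'a='a] by linarith
  have mS: "m = Suc (m - 1)" using m1 by simp
  let ?A = "\<lambda>x. (norm (x - a))\<^sup>2" and ?Z = "\<lambda>x. (norm (x - z))\<^sup>2"
  let ?I = "\<lambda>k l. \<integral>x. iter_profile ?d (-1) R ?N p 0 k (?A x) * iter_profile ?d 1 c (1/2) q 0 l (?Z x) \<partial>lborel"
  have k: "2 * (m - 1) + 2 \<le> 2 * m" and l: "2 * 0 + 2 \<le> 2 * m" using m1 by auto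
  have q1: "iter_profile ?d 1 c (1/2) q 1 0 t = 1/2 * (c + t) powr (-1/2)" for t
    by (simp add: iter_profile_def iter_coeff_def q_def)
  have "?I m 0 = ?I (Suc (m - 1)) 0" using mS by simp
  also have "\<dots> = - (\<integral>x. 4 * (iter_profile ?d (-1) R ?N p 1 (m - 1) (?A x) * iter_profile ?d 1 c (1/2) q 1 0 (?Z x) * ((x - a) \<bullet> (x - z))) \<partial>lborel)"
    by (rule green_iter_profile(1)[OF p q k l supp R])
  also have "\<dots> = ?L"
    unfolding q1 G_def p_def[symmetric]
    by (subst Bochner_Integration.integral_minus[symmetric]) (simp add: mult_ac)
  finally have L: "?I m 0 = ?L" .
  have p0: "iter_profile ?d (-1) R ?N p 0 0 t = (max 0 (R - t)) ^ (2 * m + 2)" for t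
    by (simp add: iter_profile_def iter_coeff_def p_def)
  have crit: "1/2 + ?d / 2 = real m"
  proof -
    have "real (DIM('a) + 1) = real (2 * m)" using m by (simp only:)
    then show ?thesis by simp
  qed
  have qm: "iter_profile ?d 1 c (1/2) q 0 m t = ?K * c ^ m * (c + t) powr (1/2 - real (2 * m))" for t
    unfolding iter_profile_critical[OF crit] by (simp add: q_def power_minus[of c])
  have "?I 0 m = (\<integral>x. ?K * c ^ m * ((max 0 (R - ?A x)) ^ (2 * m + 2) * (c + ?Z x) powr (1/2 - real (2 * m))) \<partial>lborel)"
    unfolding p0 qm by (intro Bochner_Integration.integral_cong) (auto simp: mult_ac)
  also have "\<dots> = ?K * c ^ m * ?J" by (rule integral_mult_right_zero)
  finally have "?I 0 m = ?K * c ^ m * ?J" .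
  moreover have "?I m 0 = ?I 0 m"
    by (rule iter_profile_adjoint[OF p q _ _ supp R]) auto
  ultimately show ?thesis using L by (simp only: mult.assoc)
qed

text \<open>Substituting \<open>x = z + \<delta> y\<close> with \<open>\<delta>\<^sup>2 = c\<close> produces the power \<open>\<delta>\<^bsup>2m + d + 1 - 4m\<^esup> = 1\<close>; then \<open>\<delta>\<close> occurs only in
  the argument of the bump.\<close>

lemma approximate_identity_powr:
  fixes a z :: "'a::euclidean_space"
  assumes m: "DIM('a) + 1 = 2 * m"
  shows "(\<lambda>n. ((1 / real (Suc n))\<^sup>2) ^ m * (\<integral>x. (max 0 (R - (norm (x - a))\<^sup>2)) ^ N *
            ((1 / real (Suc n))\<^sup>2 + (norm (x - z))\<^sup>2) powr (1/2 - real (2 * m)) \<partial>lborel))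
         \<longlonglongrightarrow> (\<integral>y. (1 + (norm (y::'a))\<^sup>2) powr (1/2 - real (2 * m)) \<partial>lborel) * (max 0 (R - (norm (z - a))\<^sup>2)) ^ N"
proof -
  let ?s = "1/2 - real (2 * m)"
  have s: "?s \<le> - real DIM('a)"
  proof -
    have "real (DIM('a) + 1) = real (2 * m)" using m by (simp only:)
    then show ?thesis by simp
  qed
  define w where "w x = (max 0 (R - (norm (x - a))\<^sup>2)) ^ N" for x :: 'a
  have [measurable]: "w \<in> borel_measurable borel" unfolding w_def by measurable
  have wb: "\<bar>w x\<bar> \<le> (max 0 R) ^ N" for x
  proof -
    have "max 0 (R - (norm (x - a))\<^sup>2) \<le> max 0 R" using zero_le_power2[of "norm (x - a)"] by linarith
    then show ?thesis unfolding w_def by (subst abs_of_nonneg) (auto intro: power_mono)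
  qed
  have eq: "(\<delta>\<^sup>2) ^ m * (\<integral>x. w x * (\<delta>\<^sup>2 + (norm (x - z))\<^sup>2) powr ?s \<partial>lborel)
      = (\<integral>y. w (z + \<delta> *\<^sub>R y) * (1 + (norm y)\<^sup>2) powr ?s \<partial>lborel)" if \<delta>: "0 < \<delta>" for \<delta>
  proof -
    have "(\<integral>x. w x * (\<delta>\<^sup>2 + (norm (x - z))\<^sup>2) powr ?s \<partial>lborel) =
       \<bar>\<delta>\<bar> ^ DIM('a) * (\<integral>y. w (z + \<delta> *\<^sub>R y) * (\<delta>\<^sup>2 + (norm (z + \<delta> *\<^sub>R y - z))\<^sup>2) powr ?s \<partial>lborel)"
      using \<delta> by (intro lborel_integral_affine) auto
    also have "\<dots> = \<delta> ^ DIM('a) * (\<integral>y. (\<delta>\<^sup>2) powr ?s * (w (z + \<delta> *\<^sub>R y) * (1 + (norm y)\<^sup>2) powr ?s) \<partial>lborel)"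
    proof -
      have "(\<delta>\<^sup>2 + (norm (z + \<delta> *\<^sub>R y - z))\<^sup>2) powr ?s = (\<delta>\<^sup>2) powr ?s * (1 + (norm y)\<^sup>2) powr ?s" for y :: 'a
      proof -
        have "\<delta>\<^sup>2 + (norm (z + \<delta> *\<^sub>R y - z))\<^sup>2 = \<delta>\<^sup>2 * (1 + (norm y)\<^sup>2)"
          by (simp add: power_mult_distrib distrib_left)
        then show ?thesis by (simp add: powr_mult)
      qed
      then show ?thesis using \<delta> by (simp add: mult_ac)
    qed
    also have "\<dots> = \<delta> ^ DIM('a) * ((\<delta>\<^sup>2) powr ?s * (\<integral>y. w (z + \<delta> *\<^sub>R y) * (1 + (norm y)\<^sup>2) powr ?s \<partial>lborel))"
      by simp
    finally have *: "(\<integral>x. w x * (\<delta>\<^sup>2 + (norm (x - z))\<^sup>2) powr ?s \<partial>lborel) = \<dots>" .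
    have "(\<delta>\<^sup>2) ^ m * (\<delta> ^ DIM('a) * (\<delta>\<^sup>2) powr ?s) = \<delta> powr (2 * real m + real DIM('a) + 2 * ?s)"
    proof -
      have "(\<delta>\<^sup>2) ^ m = \<delta> powr (2 * real m)"
        using \<delta> powr_realpow[of \<delta> "2 * m"] by (simp add: power_mult)
      moreover have "\<delta> ^ DIM('a) = \<delta> powr real DIM('a)"
        using \<delta> by (simp add: powr_realpow)
      moreover have "(\<delta>\<^sup>2) powr ?s = \<delta> powr (2 * ?s)"
        using \<delta> powr_powr[of \<delta> 2 ?s] by (simp add: powr_numeral)
      ultimately show ?thesis by (simp only: powr_add mult.assoc)
    qed
    also have "2 * real m + real DIM('a) + 2 * ?s = 0"
    proof -
      have "real (DIM('a) + 1) = real (2 * m)" using m by (simp only:)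
      then show ?thesis by simp
    qed
    finally have "(\<delta>\<^sup>2) ^ m * (\<delta> ^ DIM('a) * (\<delta>\<^sup>2) powr ?s) = 1" using \<delta> by simp
    then show ?thesis unfolding * by (simp add: mult.assoc[symmetric])
  qed
  have "(\<lambda>n. \<integral>y. w (z + (1 / real (Suc n)) *\<^sub>R y) * (1 + (norm y)\<^sup>2) powr ?s \<partial>lborel)
     \<longlonglongrightarrow> (\<integral>y. w z * (1 + (norm (y::'a))\<^sup>2) powr ?s \<partial>lborel)"
  proof (rule integral_dominated_convergence)
    show "integrable lborel (\<lambda>y::'a. (max 0 R) ^ N * (1 + (norm y)\<^sup>2) powr ?s)"
      by (intro integrable_mult_right integrable_japanese_bracket s)
    show "AE y in lborel. norm (w (z + (1 / real (Suc n)) *\<^sub>R y) * (1 + (norm y)\<^sup>2) powr ?s)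
           \<le> (max 0 R) ^ N * (1 + (norm y)\<^sup>2) powr ?s" for n
      using wb by (auto simp: abs_mult intro!: mult_right_mono)
    have "(\<lambda>n. w (z + (1 / real (Suc n)) *\<^sub>R y)) \<longlonglongrightarrow> w (z + 0 *\<^sub>R y)" for y
      unfolding w_def using LIMSEQ_inverse_real_of_nat
      by (intro tendsto_intros) (auto simp: inverse_eq_divide)
    then show "AE y in lborel. (\<lambda>n. w (z + (1 / real (Suc n)) *\<^sub>R y) * (1 + (norm y)\<^sup>2) powr ?s)
       \<longlonglongrightarrow> w z * (1 + (norm y)\<^sup>2) powr ?s"
      by (auto intro!: tendsto_mult_right)
  qed measurable
  then have "(\<lambda>n. ((1 / real (Suc n))\<^sup>2) ^ m * (\<integral>x. w x * ((1 / real (Suc n))\<^sup>2 + (norm (x - z))\<^sup>2) powr ?s \<partial>lborel))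
      \<longlonglongrightarrow> (\<integral>y. w z * (1 + (norm (y::'a))\<^sup>2) powr ?s \<partial>lborel)"
    by (subst eq) auto
  then show ?thesis unfolding w_def by (simp add: mult.commute)
qed

lemma integral_japanese_bracket_pos:
  assumes s: "s \<le> - real DIM('a::euclidean_space)"
  shows "0 < (\<integral>y. (1 + (norm (y::'a))\<^sup>2) powr s \<partial>lborel)"
proof -
  let ?f = "\<lambda>y::'a. (1 + (norm y)\<^sup>2) powr s"
  have pos: "?f y \<noteq> 0" for y
  proof -
    have "1 + (norm y)\<^sup>2 \<noteq> 0" using add_pos_nonneg[of 1 "(norm y)\<^sup>2"] by fastforce
    then show ?thesis by simp
  qed
  have nn: "AE y in lborel. 0 \<le> ?f y" by simp
  have "integral\<^sup>L lborel ?f \<noteq> 0"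
  proof
    assume "integral\<^sup>L lborel ?f = 0"
    then have "AE y in lborel. ?f y = 0"
      using integral_nonneg_eq_0_iff_AE[OF integrable_japanese_bracket[OF s] nn] by blast
    then have "eventually (\<lambda>y::'a. False) (ae_filter lborel)"
      by (rule eventually_mono) (use pos in blast)
    then show False unfolding eventually_False ae_filter_eq_bot_iff by simp
  qed
  moreover have "0 \<le> integral\<^sup>L lborel ?f" by (rule integral_nonneg_AE[OF nn])
  ultimately show ?thesis by linarith
qed

section \<open>Bumps as potentials of the sign kernel\<close>

lemma regularised_sgn_bound:
  fixes u :: "'a::euclidean_space"
  assumes "0 < c"
  shows "norm ((c + (norm u)\<^sup>2) powr (-1/2) *\<^sub>R u) \<le> 1"
proof -
  have pos: "0 < c + (norm u)\<^sup>2" using assms by (simp add: add_pos_nonneg)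
  have "norm u = sqrt ((norm u)\<^sup>2)" by simp
  also have "\<dots> \<le> sqrt (c + (norm u)\<^sup>2)" using assms by (intro real_sqrt_le_mono) simp
  also have "\<dots> = (c + (norm u)\<^sup>2) powr (1/2)" using pos by (simp add: powr_half_sqrt)
  finally have "(c + (norm u)\<^sup>2) powr (-1/2) * norm u \<le> (c + (norm u)\<^sup>2) powr (-1/2) * (c + (norm u)\<^sup>2) powr (1/2)"
    by (intro mult_left_mono) auto
  also have "\<dots> = 1" using pos by (simp add: powr_add[symmetric])
  finally show ?thesis by simp
qed

lemma regularised_sgn_tendsto:
  fixes u :: "'a::euclidean_space"
  shows "(\<lambda>n. ((1 / real (Suc n))\<^sup>2 + (norm u)\<^sup>2) powr (-1/2) *\<^sub>R u) \<longlonglongrightarrow> sgn u"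
proof (cases "u = 0")
  case False
  have "(\<lambda>n. 1 / real (Suc n)) \<longlonglongrightarrow> 0"
    using LIMSEQ_inverse_real_of_nat by (simp add: inverse_eq_divide)
  then have "(\<lambda>n. ((1 / real (Suc n))\<^sup>2 + (norm u)\<^sup>2) powr (-1/2) *\<^sub>R u) \<longlonglongrightarrow> (0\<^sup>2 + (norm u)\<^sup>2) powr (-1/2) *\<^sub>R u"
    using False by (intro tendsto_intros) auto
  moreover have "(0\<^sup>2 + (norm u)\<^sup>2) powr (-1/2) = inverse (norm u)"
    using False by (simp add: powr_minus powr_half_sqrt)
  ultimately show ?thesis by (simp add: sgn_div_norm)
qed simp

text \<open>The limit \<open>c \<rightarrow> 0\<close> of \<open>regularised_kernel_identity\<close>, the gradient of the regularised norm tending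
  boundedly to \<open>sgn (x - z)\<close>. Here \<open>V\<close> is minus the gradient of the \<open>(m - 1)\<close>-st Laplacian of the bump,
  \<open>C\<close> is the value of \<open>\<Delta>\<^sup>m \<bar>x\<bar>\<close> as a multiple of the point mass at 0, and \<open>DIM('a) + 3 = 2 m + 2\<close>.\<close>

lemma bump_as_sgn_potential:
  fixes a :: "'a::euclidean_space"
  assumes "odd DIM('a)" and R: "0 \<le> R"
  obtains C V where "C \<noteq> 0" "continuous_on UNIV V" "\<And>x::'a. R \<le> (norm (x - a))\<^sup>2 \<Longrightarrow> V x = (0::'a)"
    "\<And>z. (\<integral>x. V x \<bullet> sgn (x - z) \<partial>lborel) = C * (max 0 (R - (norm (z - a))\<^sup>2)) ^ (DIM('a) + 3)"
proof -
  have "even (DIM('a) + 1)" using assms(1) by simp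
  then obtain m where m: "DIM('a) + 1 = 2 * m" by (rule evenE)
  have m1: "1 \<le> m" using m DIM_positive[where 'a='a] by linarith
  let ?s = "1/2 - real (2 * m)"
  let ?w = "\<lambda>i t. (max 0 (R - t)) ^ (2 * m + 2 - i)"
  have p: "power_ladder (-1) R (real (2 * m + 2)) (2 * m) ?w"
    by (rule power_ladder_truncated) simp
  define G where "G = iter_profile (real DIM('a)) (-1) R (real (2 * m + 2)) ?w 1 (m - 1)"
  define V where "V x = (- 2 * G ((norm (x - a))\<^sup>2)) *\<^sub>R (x - a)" for x
  define K where "K = 4 ^ m * (- 1) ^ m * (\<Prod>i<2 * m. 1/2 - real i)"
  define \<kappa> where "\<kappa> = (\<integral>y. (1 + (norm (y::'a))\<^sup>2) powr ?s \<partial>lborel)"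
  have s: "?s \<le> - real DIM('a)"
  proof -
    have "real (DIM('a) + 1) = real (2 * m)" using m by (simp only:)
    then show ?thesis by simp
  qed
  have "1/2 - real i \<noteq> 0" for i
  proof
    assume "1/2 - real i = 0"
    then have "real (2 * i) = real 1" by simp
    then have "2 * i = 1" by (simp only: of_nat_eq_iff)
    then show False by presburger
  qed
  then have "K \<noteq> 0" unfolding K_def by simp
  moreover have "0 < \<kappa>" unfolding \<kappa>_def by (rule integral_japanese_bracket_pos[OF s])
  ultimately have "K * \<kappa> \<noteq> 0" by simp
  moreover have "continuous_on {0..} G"
    unfolding G_def by (rule continuous_on_iter_profile[OF p]) (use m1 in auto)
  then have V: "continuous_on UNIV V"
    unfolding V_def by (intro continuous_intros continuous_on_radial)
  moreover have Vsupp: "V x = 0" if "R \<le> (norm (x - a))\<^sup>2" for x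
  proof -
    have "G ((norm (x - a))\<^sup>2) = 0"
      unfolding G_def
      by (rule iter_profile_support[where M = "2 * m" and R = R]) (use m1 that in \<open>auto simp: power_0_left\<close>)
    then show ?thesis by (simp add: V_def)
  qed
  moreover have "(\<integral>x. V x \<bullet> sgn (x - z) \<partial>lborel) = K * \<kappa> * (max 0 (R - (norm (z - a))\<^sup>2)) ^ (DIM('a) + 3)" for z
  proof -
    let ?c = "\<lambda>n. (1 / real (Suc n))\<^sup>2"
    let ?k = "\<lambda>n x. (?c n + (norm (x - z))\<^sup>2) powr (-1/2) *\<^sub>R (x - z)"
    have Vm [measurable]: "V \<in> borel_measurable borel" using V by (rule borel_measurable_continuous_onI)
    have "(\<lambda>n. \<integral>x. V x \<bullet> ?k n x \<partial>lborel) \<longlonglongrightarrow> (\<integral>x. V x \<bullet> sgn (x - z) \<partial>lborel)"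
    proof (rule integral_dominated_convergence)
      have "integrable lborel V"
        by (rule integrable_continuous_bounded_support[OF V, of "norm a + sqrt R"])
           (use R Vsupp radial_support in blast)
      then show "integrable lborel (\<lambda>x. norm (V x))" by (rule integrable_norm)
      show "AE x in lborel. norm (V x \<bullet> ?k n x) \<le> norm (V x)" for n
      proof (rule AE_I2)
        fix x
        have "norm (V x \<bullet> ?k n x) \<le> norm (V x) * norm (?k n x)"
          using Cauchy_Schwarz_ineq2[of "V x" "?k n x"] by simp
        also have "\<dots> \<le> norm (V x) * 1"
          by (intro mult_left_mono regularised_sgn_bound) auto
        finally show "norm (V x \<bullet> ?k n x) \<le> norm (V x)" by simp
      qed
      show "AE x in lborel. (\<lambda>n. V x \<bullet> ?k n x) \<longlonglongrightarrow> V x \<bullet> sgn (x - z)"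
        by (intro AE_I2 tendsto_intros regularised_sgn_tendsto)
    qed measurable
    moreover have "(\<integral>x. V x \<bullet> ?k n x \<partial>lborel) = K * (?c n ^ m * (\<integral>x. (max 0 (R - (norm (x - a))\<^sup>2)) ^ (2 * m + 2) * (?c n + (norm (x - z))\<^sup>2) powr ?s \<partial>lborel))" for n
    proof -
      have "(\<integral>x. V x \<bullet> ?k n x \<partial>lborel) = (\<integral>x. - 2 * G ((norm (x - a))\<^sup>2) * ((x - a) \<bullet> (x - z)) * (?c n + (norm (x - z))\<^sup>2) powr (-1/2) \<partial>lborel)"
        unfolding V_def by (intro Bochner_Integration.integral_cong) simp_all
      then show ?thesis
        unfolding G_def K_def using regularised_kernel_identity[OF m _ R, of "?c n" a z] by simp
    qed
    ultimately have "(\<lambda>n. K * (?c n ^ m * (\<integral>x. (max 0 (R - (norm (x - a))\<^sup>2)) ^ (2 * m + 2) * (?c n + (norm (x - z))\<^sup>2) powr ?s \<partial>lborel)))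
       \<longlonglongrightarrow> (\<integral>x. V x \<bullet> sgn (x - z) \<partial>lborel)" by simp
    moreover have "(\<lambda>n. K * (?c n ^ m * (\<integral>x. (max 0 (R - (norm (x - a))\<^sup>2)) ^ (2 * m + 2) * (?c n + (norm (x - z))\<^sup>2) powr ?s \<partial>lborel)))
       \<longlonglongrightarrow> K * (\<kappa> * (max 0 (R - (norm (z - a))\<^sup>2)) ^ (2 * m + 2))"
      unfolding \<kappa>_def by (intro tendsto_mult_left approximate_identity_powr m)
    ultimately have "(\<integral>x. V x \<bullet> sgn (x - z) \<partial>lborel) = K * (\<kappa> * (max 0 (R - (norm (z - a))\<^sup>2)) ^ (2 * m + 2))"
      by (rule LIMSEQ_unique)
    moreover have "2 * m + 2 = DIM('a) + 3" using m by simp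
    ultimately show ?thesis by (simp only: mult.assoc)
  qed
  ultimately show thesis using that by blast
qed

section \<open>From equal sign means to equal measures\<close>

lemma Fubini_lborel_prob:
  fixes f :: "'a::euclidean_space \<Rightarrow> 'b::topological_space \<Rightarrow> real"
  assumes P: "prob_space P" and [measurable_cong]: "sets P = sets borel"
    and f [measurable]: "case_prod f \<in> borel_measurable (borel \<Otimes>\<^sub>M borel)"
    and bound: "\<And>x z. \<bar>f x z\<bar> \<le> g x" and g: "integrable lborel g"
  shows "(\<integral>z. (\<integral>x. f x z \<partial>lborel) \<partial>P) = (\<integral>x. (\<integral>z. f x z \<partial>P) \<partial>lborel)"
proof -
  interpret P: prob_space P by (rule P)
  interpret pair_sigma_finite lborel P
    by (intro pair_sigma_finite.intro sigma_finite_lborel P.sigma_finite_measure_axioms)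
  have fP [measurable]: "case_prod f \<in> borel_measurable (lborel \<Otimes>\<^sub>M P)"
    by (subst measurable_cong_sets[OF sets_pair_measure_cong[OF sets_lborel assms(2)] refl]) (rule f)
  have fx: "integrable P (f x)" for x
  proof (rule P.integrable_const_bound)
    show "AE z in P. norm (f x z) \<le> g x" using bound by simp
    show "f x \<in> borel_measurable P" by measurable
  qed
  show ?thesis
  proof (rule Fubini_integral, rule Fubini_integrable)
    show "integrable lborel (\<lambda>x. \<integral>z. norm (case (x, z) of (x, z) \<Rightarrow> f x z) \<partial>P)"
    proof (rule Bochner_Integration.integrable_bound[OF g])
      show "(\<lambda>x. \<integral>z. norm (case (x, z) of (x, z) \<Rightarrow> f x z) \<partial>P) \<in> borel_measurable lborel"
        by measurable
      have "\<bar>\<integral>z. \<bar>f x z\<bar> \<partial>P\<bar> \<le> \<bar>g x\<bar>" for x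
      proof -
        have "0 \<le> (\<integral>z. \<bar>f x z\<bar> \<partial>P)" by (intro integral_nonneg_AE) simp
        moreover have "(\<integral>z. \<bar>f x z\<bar> \<partial>P) \<le> g x"
        proof -
          have "(\<integral>z. \<bar>f x z\<bar> \<partial>P) \<le> (\<integral>z. g x \<partial>P)"
            using fx bound by (intro integral_mono) auto
          then show ?thesis by (simp add: P.prob_space)
        qed
        ultimately show ?thesis by linarith
      qed
      then show "AE x in lborel. norm (\<integral>z. norm (case (x, z) of (x, z) \<Rightarrow> f x z) \<partial>P) \<le> norm (g x)"
        by simp
    qed
    show "AE x in lborel. integrable P (\<lambda>z. case (x, z) of (x, z) \<Rightarrow> f x z)" using fx by simp
  qed measurable
qed

lemma bump_integral_eq_of_sgn_mean_eq:
  fixes P Q :: "'a::euclidean_space measure"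
  assumes dim: "odd DIM('a)" and R: "0 \<le> R"
    and P: "prob_space P" "sets P = sets borel" and Q: "prob_space Q" "sets Q = sets borel"
    and eq: "\<And>x. (norm (x - a))\<^sup>2 \<le> R \<Longrightarrow> (\<integral>z. sgn (x - z) \<partial>P) = (\<integral>z. sgn (x - z) \<partial>Q)"
  shows "(\<integral>z. (max 0 (R - (norm (z - a))\<^sup>2)) ^ (DIM('a) + 3) \<partial>P)
       = (\<integral>z. (max 0 (R - (norm (z - a))\<^sup>2)) ^ (DIM('a) + 3) \<partial>Q)"
proof -
  obtain C V where C: "C \<noteq> 0" and V: "continuous_on UNIV V"
    and supp: "\<And>x. R \<le> (norm (x - a))\<^sup>2 \<Longrightarrow> V x = (0::'a)"
    and pot: "\<And>z. (\<integral>x. V x \<bullet> sgn (x - z) \<partial>lborel) = C * (max 0 (R - (norm (z - a))\<^sup>2)) ^ (DIM('a) + 3)"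
    by (rule bump_as_sgn_potential[OF dim R, of a]) (rule that)
  have [measurable]: "V \<in> borel_measurable borel" using V by (rule borel_measurable_continuous_onI)
  have "integrable lborel V"
    by (rule integrable_continuous_bounded_support[OF V, of "norm a + sqrt R"])
       (use R supp radial_support in blast)
  then have intV: "integrable lborel (\<lambda>x. norm (V x))" by (rule integrable_norm)
  have main: "C * (\<integral>z. (max 0 (R - (norm (z - a))\<^sup>2)) ^ (DIM('a) + 3) \<partial>M) = (\<integral>x. V x \<bullet> (\<integral>z. sgn (x - z) \<partial>M) \<partial>lborel)"
    if M: "prob_space M" "sets M = sets borel" for M
  proof -
    interpret M: prob_space M by (rule M)
    note M(2) [measurable_cong]
    have "C * (\<integral>z. (max 0 (R - (norm (z - a))\<^sup>2)) ^ (DIM('a) + 3) \<partial>M) = (\<integral>z. (\<integral>x. V x \<bullet> sgn (x - z) \<partial>lborel) \<partial>M)"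
      unfolding pot by simp
    also have "\<dots> = (\<integral>x. (\<integral>z. V x \<bullet> sgn (x - z) \<partial>M) \<partial>lborel)"
    proof (rule Fubini_lborel_prob[OF M _ _ intV])
      show "(\<lambda>(x, z). V x \<bullet> sgn (x - z)) \<in> borel_measurable (borel \<Otimes>\<^sub>M borel)" by measurable
      fix x z
      have "\<bar>V x \<bullet> sgn (x - z)\<bar> \<le> norm (V x) * norm (sgn (x - z))" by (rule Cauchy_Schwarz_ineq2)
      also have "\<dots> \<le> norm (V x) * 1" by (intro mult_left_mono) (auto simp: norm_sgn)
      finally show "\<bar>V x \<bullet> sgn (x - z)\<bar> \<le> norm (V x)" by simp
    qed
    also have "\<dots> = (\<integral>x. V x \<bullet> (\<integral>z. sgn (x - z) \<partial>M) \<partial>lborel)"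
    proof -
      have "integrable M (\<lambda>z. sgn (x - z))" for x
        by (rule M.integrable_const_bound[where B = 1]) (auto simp: norm_sgn)
      then show ?thesis by simp
    qed
    finally show ?thesis .
  qed
  have "V x \<bullet> (\<integral>z. sgn (x - z) \<partial>P) = V x \<bullet> (\<integral>z. sgn (x - z) \<partial>Q)" for x
    using eq[of x] supp[of x] by (cases "(norm (x - a))\<^sup>2 \<le> R") auto
  then have "C * (\<integral>z. (max 0 (R - (norm (z - a))\<^sup>2)) ^ (DIM('a) + 3) \<partial>P)
      = C * (\<integral>z. (max 0 (R - (norm (z - a))\<^sup>2)) ^ (DIM('a) + 3) \<partial>Q)"
    unfolding main[OF P] main[OF Q] by (simp only:)
  then show ?thesis using C by simp
qed

lemma open_ball_interior:
  fixes U :: "'a::euclidean_space set"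
  assumes "open U"
  shows "open {a. cball a r \<subseteq> U}"
proof -
  have "- {a. cball a r \<subseteq> U} = (\<Union>x\<in>- U. \<Union>y\<in>cball 0 r. {x + y})"
  proof (intro set_eqI iffI)
    fix a assume "a \<in> - {a. cball a r \<subseteq> U}"
    then obtain x where "x \<in> cball a r" "x \<notin> U" by blast
    moreover from this have "a - x \<in> cball 0 r" by (simp add: dist_norm norm_minus_commute[of x a])
    ultimately show "a \<in> (\<Union>x\<in>- U. \<Union>y\<in>cball 0 r. {x + y})"
      by (intro UN_I[of x] UN_I[of "a - x"]) auto
  next
    fix a assume "a \<in> (\<Union>x\<in>- U. \<Union>y\<in>cball 0 r. {x + y})"
    then obtain x y where "x \<notin> U" "norm y \<le> r" "a = x + y" by auto
    then have "x \<in> cball a r" "x \<notin> U" by (simp_all add: dist_norm)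
    then show "a \<in> - {a. cball a r \<subseteq> U}" by blast
  qed
  moreover have "closed (\<Union>x\<in>- U. \<Union>y\<in>cball 0 r. {x + y})"
    using assms by (intro closed_compact_sums) auto
  ultimately show ?thesis by (simp only: open_closed)
qed

text \<open>Averaging the bumps of radius \<open>r\<close> over the centres \<open>a\<close> with \<open>cball a r \<subseteq> U\<close> gives, up to a power of \<open>r\<close>,
  the function \<open>\<Phi> r\<close> of the proof. It vanishes outside \<open>U\<close>, since a bump that is nonzero at \<open>z\<close> has \<open>z\<close> in
  its ball; it has the constant value \<open>\<beta>\<close> at points of \<open>U\<close> whose distance to the complement is more than
  \<open>2 r\<close>; and it lies between 0 and \<open>\<beta>\<close>. Boundedness of \<open>U\<close> makes the average integrable in \<open>a\<close>.\<close>

lemma measure_open_eq_of_bump_integrals: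
  fixes P Q :: "'a::euclidean_space measure"
  assumes P: "prob_space P" "sets P = sets borel" and Q: "prob_space Q" "sets Q = sets borel"
    and U: "open U" "bounded U" and N: "0 < N"
    and eq: "\<And>a r. 0 < r \<Longrightarrow> cball a r \<subseteq> U \<Longrightarrow>
        (\<integral>z. (max 0 (r\<^sup>2 - (norm (z - a))\<^sup>2)) ^ N \<partial>P) = (\<integral>z. (max 0 (r\<^sup>2 - (norm (z - a))\<^sup>2)) ^ N \<partial>Q)"
  shows "measure P U = measure Q U"
proof -
  define W where "W r = {a. cball a r \<subseteq> U}" for r
  have W [measurable]: "W r \<in> sets borel" for r
    unfolding W_def using open_ball_interior[OF U(1)] by (intro borel_open)
  define w where "w r a z = (max 0 (r\<^sup>2 - (norm (z - a))\<^sup>2)) ^ N" for r and a z :: 'a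
  define b where "b y = (max 0 (1 - (norm y)\<^sup>2)) ^ N" for y :: 'a
  define \<beta> where "\<beta> = integral\<^sup>L lborel b"
  have [measurable]: "b \<in> borel_measurable borel" unfolding b_def by measurable
  have b_nonneg: "0 \<le> b y" for y unfolding b_def by simp
  have b_zero: "b y = 0" if "1 \<le> norm y" for y
    using that N one_le_power[of "norm y" 2] by (simp add: b_def)
  have int_b: "integrable lborel b"
  proof (rule integrable_continuous_bounded_support[of _ 1])
    show "continuous_on UNIV b" unfolding b_def by (intro continuous_intros)
  qed (use b_zero in auto)
  have \<beta>: "0 < \<beta>"
  proof -
    have "\<beta> \<noteq> 0"
    proof
      assume "\<beta> = 0"
      then have "AE y in lborel. b y = 0"
        using integral_nonneg_eq_0_iff_AE[OF int_b] b_nonneg unfolding \<beta>_def by auto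
      then have "AE y::'a in lborel. y \<notin> ball 0 1"
      proof (rule eventually_mono)
        fix y assume "b y = 0"
        then have "1 \<le> (norm y)\<^sup>2" using N by (auto simp: b_def max_def split: if_splits)
        then show "y \<notin> ball 0 1" using abs_square_less_1[of "norm y"] by auto
      qed
      then have "emeasure lborel (ball (0::'a) 1) = 0"
        by (subst (asm) AE_iff_measurable[OF _ refl]) (auto simp: ball_def)
      then show False using unit_ball_vol_pos[of "real DIM('a)"] by (simp add: emeasure_ball)
    qed
    moreover have "0 \<le> \<beta>" unfolding \<beta>_def using b_nonneg by (intro integral_nonneg_AE) auto
    ultimately show ?thesis by simp
  qed
  define \<Phi> where "\<Phi> r z = (\<integral>y. indicator (W r) (z + r *\<^sub>R y) * b y \<partial>lborel)" for r and z :: 'a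
  have scale: "(\<integral>a. indicator (W r) a * w r a z \<partial>lborel) = r ^ DIM('a) * (r\<^sup>2) ^ N * \<Phi> r z" if r: "0 < r" for r z
  proof -
    have "(\<integral>a. indicator (W r) a * w r a z \<partial>lborel) = \<bar>r\<bar> ^ DIM('a) * (\<integral>y. indicator (W r) (z + r *\<^sub>R y) * w r (z + r *\<^sub>R y) z \<partial>lborel)"
      using r by (intro lborel_integral_affine) (auto simp: w_def)
    also have "(\<lambda>y. indicator (W r) (z + r *\<^sub>R y) * w r (z + r *\<^sub>R y) z) = (\<lambda>y. (r\<^sup>2) ^ N * (indicator (W r) (z + r *\<^sub>R y) * b y))"
    proof
      fix y
      have "r\<^sup>2 - (norm (z - (z + r *\<^sub>R y)))\<^sup>2 = r\<^sup>2 * (1 - (norm y)\<^sup>2)"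
        by (simp add: power_mult_distrib right_diff_distrib)
      moreover have "max 0 (r\<^sup>2 * (1 - (norm y)\<^sup>2)) = r\<^sup>2 * max 0 (1 - (norm y)\<^sup>2)"
        using r by (simp add: max_mult_distrib_left)
      ultimately have "w r (z + r *\<^sub>R y) z = (r\<^sup>2) ^ N * b y"
        unfolding w_def b_def by (simp add: power_mult_distrib)
      then show "indicator (W r) (z + r *\<^sub>R y) * w r (z + r *\<^sub>R y) z = (r\<^sup>2) ^ N * (indicator (W r) (z + r *\<^sub>R y) * b y)"
        by simp
    qed
    finally show ?thesis using r by (simp add: \<Phi>_def)
  qed
  have \<Phi>_swap: "r ^ DIM('a) * (r\<^sup>2) ^ N * (\<integral>z. \<Phi> r z \<partial>M) = (\<integral>a. indicator (W r) a * (\<integral>z. w r a z \<partial>M) \<partial>lborel)"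
    if r: "0 < r" and M: "prob_space M" "sets M = sets borel" for r M
  proof -
    note M(2) [measurable_cong]
    have "r ^ DIM('a) * (r\<^sup>2) ^ N * (\<integral>z. \<Phi> r z \<partial>M) = (\<integral>z. (\<integral>a. indicator (W r) a * w r a z \<partial>lborel) \<partial>M)"
      unfolding scale[OF r] by simp
    also have "\<dots> = (\<integral>a. (\<integral>z. indicator (W r) a * w r a z \<partial>M) \<partial>lborel)"
    proof (rule Fubini_lborel_prob[OF M])
      show "(\<lambda>(a, z). indicator (W r) a * w r a z) \<in> borel_measurable (borel \<Otimes>\<^sub>M borel)"
        unfolding w_def by measurable
      have "\<bar>w r a z\<bar> \<le> (r\<^sup>2) ^ N" for a z
        unfolding w_def by (auto intro!: power_mono)
      then show "\<bar>indicator (W r) a * w r a z\<bar> \<le> indicator (W r) a * (r\<^sup>2) ^ N" for a z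
        by (auto simp: indicator_def)
      have "W r \<subseteq> U" unfolding W_def using r by (auto simp: subset_iff)
      then have "emeasure lborel (W r) < \<infinity>"
        using U(2) emeasure_bounded_finite bounded_subset by metis
      then show "integrable lborel (\<lambda>a. indicator (W r) a * (r\<^sup>2) ^ N)"
        by (intro integrable_mult_left integrable_real_indicator) auto
    qed
    finally show ?thesis by simp
  qed
  have \<Phi>_eq: "(\<integral>z. \<Phi> r z \<partial>P) = (\<integral>z. \<Phi> r z \<partial>Q)" if r: "0 < r" for r
  proof -
    have "(\<lambda>a. indicator (W r) a * (\<integral>z. w r a z \<partial>P)) = (\<lambda>a. indicator (W r) a * (\<integral>z. w r a z \<partial>Q))"
      using eq[OF r] by (auto simp: fun_eq_iff indicator_def W_def w_def)
    then have "r ^ DIM('a) * (r\<^sup>2) ^ N * (\<integral>z. \<Phi> r z \<partial>P) = r ^ DIM('a) * (r\<^sup>2) ^ N * (\<integral>z. \<Phi> r z \<partial>Q)"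
      unfolding \<Phi>_swap[OF r P] \<Phi>_swap[OF r Q] by (simp only:)
    then show ?thesis using r by simp
  qed
  have \<Phi>_outside: "\<Phi> r z = 0" if "0 < r" "z \<notin> U" for r z
  proof -
    have "indicator (W r) (z + r *\<^sub>R y) * b y = 0" for y
    proof (cases "norm y < 1")
      case True
      then have "z \<in> cball (z + r *\<^sub>R y) r" using that(1) by (simp add: dist_norm)
      then have "z + r *\<^sub>R y \<notin> W r" using that(2) unfolding W_def by blast
      then show ?thesis by simp
    qed (simp add: b_zero)
    then show ?thesis unfolding \<Phi>_def by (simp only: Bochner_Integration.integral_zero)
  qed
  have \<Phi>_inside: "\<Phi> r z = \<beta>" if "0 < r" "cball z (2 * r) \<subseteq> U" for r z
  proof -
    have "indicator (W r) (z + r *\<^sub>R y) * b y = b y" for y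
    proof (cases "norm y < 1")
      case True
      have "cball (z + r *\<^sub>R y) r \<subseteq> cball z (2 * r)"
      proof
        fix x assume "x \<in> cball (z + r *\<^sub>R y) r"
        moreover have "dist z (z + r *\<^sub>R y) \<le> r" using that(1) True by (simp add: dist_norm)
        ultimately show "x \<in> cball z (2 * r)"
          using dist_triangle[of z x "z + r *\<^sub>R y"] by simp
      qed
      then have "z + r *\<^sub>R y \<in> W r" using that(2) unfolding W_def by blast
      then show ?thesis by simp
    qed (simp add: b_zero)
    then show ?thesis unfolding \<Phi>_def \<beta>_def by (simp only:)
  qed
  have \<Phi>_bound: "\<bar>\<Phi> r z\<bar> \<le> \<beta>" for r z
  proof -
    have int: "integrable lborel (\<lambda>y. indicator (W r) (z + r *\<^sub>R y) * b y)"
      by (rule Bochner_Integration.integrable_bound[OF int_b])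
         (auto simp: indicator_def b_nonneg)
    have "\<Phi> r z \<le> \<beta>" unfolding \<Phi>_def \<beta>_def
      by (rule integral_mono[OF int int_b]) (auto simp: indicator_def b_nonneg)
    moreover have "0 \<le> \<Phi> r z" unfolding \<Phi>_def
      by (intro integral_nonneg_AE) (auto simp: indicator_def b_nonneg)
    ultimately show ?thesis by simp
  qed
  let ?r = "\<lambda>n. 1 / real (Suc n)"
  have lim: "(\<lambda>n. \<integral>z. \<Phi> (?r n) z \<partial>M) \<longlonglongrightarrow> \<beta> * measure M U"
    if M: "prob_space M" "sets M = sets borel" for M
  proof -
    interpret M: prob_space M by (rule M)
    note M(2) [measurable_cong]
    have UM: "U \<in> sets M" using U(1) M(2) by simp
    have "(\<lambda>n. \<integral>z. \<Phi> (?r n) z \<partial>M) \<longlonglongrightarrow> (\<integral>z. \<beta> * indicator U z \<partial>M)"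
    proof (rule integral_dominated_convergence)
      show "integrable M (\<lambda>_. \<beta>)" by simp
      show "(\<lambda>z. \<beta> * indicator U z) \<in> borel_measurable M" using UM by measurable
      show "\<Phi> (?r n) \<in> borel_measurable M" for n
        unfolding \<Phi>_def by measurable
      show "AE z in M. (\<lambda>n. \<Phi> (?r n) z) \<longlonglongrightarrow> \<beta> * indicator U z"
      proof (rule AE_I2)
        fix z
        show "(\<lambda>n. \<Phi> (?r n) z) \<longlonglongrightarrow> \<beta> * indicator U z"
        proof (cases "z \<in> U")
          case True
          then obtain e where e: "0 < e" "cball z e \<subseteq> U"
            using U(1) open_contains_cball by blast
          have "(\<lambda>n. 2 * ?r n) \<longlonglongrightarrow> 2 * 0"
            using LIMSEQ_inverse_real_of_nat by (intro tendsto_mult_left) (simp add: inverse_eq_divide)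
          then have "\<forall>\<^sub>F n in sequentially. 2 * ?r n < e"
            using e(1) by (intro order_tendstoD(2)[where y = "2 * 0"]) auto
          then have "\<forall>\<^sub>F n in sequentially. \<Phi> (?r n) z = \<beta>"
          proof (rule eventually_mono)
            fix n assume "2 * ?r n < e"
            then have "cball z (2 * ?r n) \<subseteq> U" using e(2) by (auto simp: subset_iff)
            then show "\<Phi> (?r n) z = \<beta>" by (intro \<Phi>_inside) auto
          qed
          then show ?thesis using True by (simp add: tendsto_eventually)
        next
          case False
          then show ?thesis by (simp add: \<Phi>_outside)
        qed
      qed
    qed (use \<Phi>_bound in auto)
    then show ?thesis using UM by simp
  qed
  have "\<beta> * measure P U = \<beta> * measure Q U"
  proof (rule LIMSEQ_unique[OF lim[OF P]])
    show "(\<lambda>n. \<integral>z. \<Phi> (?r n) z \<partial>P) \<longlonglongrightarrow> \<beta> * measure Q U"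
      using lim[OF Q] by (subst \<Phi>_eq) auto
  qed
  then show ?thesis using \<beta> by simp
qed

text \<open>The restrictions of both measures to \<open>\<Omega>\<close> agree on open boxes, which generate the Borel sets and
  are stable under intersection.\<close>

lemma measure_eq_of_bounded_open_eq:
  fixes P Q :: "'a::euclidean_space measure"
  assumes P: "prob_space P" "sets P = sets borel" and Q: "prob_space Q" "sets Q = sets borel"
    and \<Omega>: "open \<Omega>"
    and eq: "\<And>U. open U \<Longrightarrow> bounded U \<Longrightarrow> U \<subseteq> \<Omega> \<Longrightarrow> measure P U = measure Q U"
    and E: "E \<in> sets borel" "E \<subseteq> \<Omega>"
  shows "measure P E = measure Q E"
proof -
  interpret P: prob_space P by (rule P)
  interpret Q: prob_space Q by (rule Q)
  let ?B = "range (\<lambda>(a, b). box a b :: 'a set)"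
  have meas: "A \<in> sets P \<and> A \<in> sets Q" if "A \<in> sets borel" for A using that P Q by simp
  have \<Omega>m: "\<Omega> \<in> sets P" "\<Omega> \<in> sets Q" using meas \<Omega> by auto
  have eqB: "density P (indicator \<Omega>) = density Q (indicator \<Omega>)"
  proof (rule measure_eqI_generator_eq[where E = ?B and \<Omega> = UNIV and A = "\<lambda>n. box (- (real n *\<^sub>R One)) (real n *\<^sub>R One)"])
    show "Int_stable ?B" by (auto simp: Int_stable_def box_Int_box)
    fix X assume "X \<in> ?B"
    then obtain a b where X: "X = box a b" by auto
    have "measure P (\<Omega> \<inter> X) = measure Q (\<Omega> \<inter> X)"
      using \<Omega> by (intro eq) (auto simp: X intro: bounded_subset[OF bounded_box])
    moreover have "X \<in> sets P" "X \<in> sets Q" using meas by (auto simp: X)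
    ultimately show "emeasure (density P (indicator \<Omega>)) X = emeasure (density Q (indicator \<Omega>)) X"
      using \<Omega>m by (simp add: emeasure_restricted P.emeasure_eq_measure Q.emeasure_eq_measure)
  next
    show "sets (density P (indicator \<Omega>)) = sigma_sets UNIV ?B" "sets (density Q (indicator \<Omega>)) = sigma_sets UNIV ?B"
      using P Q by (simp_all add: borel_eq_box)
    show "emeasure (density P (indicator \<Omega>)) (box (- (real n *\<^sub>R One)) (real n *\<^sub>R One)) \<noteq> \<infinity>" for n
      using meas \<Omega>m by (simp add: emeasure_restricted)
  qed (auto simp: UN_box_eq_UNIV)
  have "emeasure P (\<Omega> \<inter> E) = emeasure Q (\<Omega> \<inter> E)"
    using arg_cong[OF eqB, of "\<lambda>M. emeasure M E"] meas[OF E(1)] \<Omega>m by (simp add: emeasure_restricted)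
  moreover have "\<Omega> \<inter> E = E" using E(2) by auto
  ultimately show ?thesis by (simp add: measure_def)
qed

text \<open>The library convention \<open>sgn 0 = 0\<close> absorbs the indicator of \<open>z \<noteq> x\<close>.\<close>

lemma geometric_cdf_eq_mean_sgn: "geometric_cdf P x = (\<integral>z. sgn (x - z) \<partial>P)"
  unfolding geometric_cdf_def
  by (intro Bochner_Integration.integral_cong) (auto simp: sgn_div_norm indicator_def)

theorem proposition5p1:
  fixes P Q :: "(real ^ 'd) measure" and \<Omega> :: "(real ^ 'd) set"
  assumes "odd CARD('d)"
    and "borel_probability P" and "borel_probability Q"
    and "open \<Omega>"
    and "\<And>x. x \<in> \<Omega> \<Longrightarrow> geometric_cdf P x = geometric_cdf Q x"
  shows "\<forall>E \<in> sets borel. E \<subseteq> \<Omega> \<longrightarrow> measure P E = measure Q E"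
proof (intro ballI impI)
  fix E :: "(real ^ 'd) set"
  assume E: "E \<in> sets borel" "E \<subseteq> \<Omega>"
  have P: "prob_space P" "sets P = sets borel" and Q: "prob_space Q" "sets Q = sets borel"
    using assms(2,3) by (simp_all add: borel_probability_def)
  have dim: "odd DIM(real ^ 'd)" using assms(1) by simp
  show "measure P E = measure Q E"
  proof (rule measure_eq_of_bounded_open_eq[OF P Q assms(4) _ E])
    fix U assume U: "open U" "bounded U" "U \<subseteq> \<Omega>"
    show "measure P U = measure Q U"
    proof (rule measure_open_eq_of_bump_integrals[OF P Q U(1,2), of "DIM(real ^ 'd) + 3"])
      fix a :: "real ^ 'd" and r :: real
      assume r: "0 < r" and ball: "cball a r \<subseteq> U"
      show "(\<integral>z. (max 0 (r\<^sup>2 - (norm (z - a))\<^sup>2)) ^ (DIM(real ^ 'd) + 3) \<partial>P)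
          = (\<integral>z. (max 0 (r\<^sup>2 - (norm (z - a))\<^sup>2)) ^ (DIM(real ^ 'd) + 3) \<partial>Q)"
      proof (rule bump_integral_eq_of_sgn_mean_eq[OF dim _ P Q])
        fix x assume "(norm (x - a))\<^sup>2 \<le> r\<^sup>2"
        then have "x \<in> cball a r"
          using r by (simp add: dist_norm norm_minus_commute power2_le_iff_abs_le)
        then have "x \<in> \<Omega>" using ball U(3) by blast
        then show "(\<integral>z. sgn (x - z) \<partial>P) = (\<integral>z. sgn (x - z) \<partial>Q)"
          using assms(5) by (simp add: geometric_cdf_eq_mean_sgn)
      qed simp
    qed simp
  qed
qed

end
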